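(* Let $\mathcal{M}=(U,\mathcal{I})$ be a matroid of rank $k$, $f\colon 2^U\to\mathbb{R}_+$ a monotone submodular function, $0<\varepsilon\le 1$, and let swap be a right continuous swap procedure that is above-average. Then the Greedy Swap Poisson Process run with $\mathcal{M}$, $\varepsilon$ and swap finds $A\in\mathcal{B}$ satisfying $\mathbb{E}[f(A)]\ge(1-\varepsilon)(1-1/e)f(O)$ using in expectation $k\ln(1/\varepsilon)$ calls to the swap procedure, where $O\in\arg\max\{f(S):S\in\mathcal{I}\}$ is an optimal base.
   Context: $\mathcal{B}$ is the set of bases of $\mathcal{M}$. Submodular: $f(S+i)-f(S)\ge f(T+i)-f(T)$ for $S\subseteq T\subseteq U$, $i\notin T$; monotone: $f(S)\le f(T)$ for $S\subseteq T$. $F(\mathbf{x})=\sum_{S\subseteq U}f(S)\prod_{i\in S}x_i\prod_{i\notin S}(1-x_i)$ is the multilinear extension, $\nabla_iF$ its partial derivative in coordinate $i$, and $\mathbf{1}_A$ the indicator vector of $A$. A swap procedure is a (possibly randomized) algorithm that, given a base $A\in\mathcal{B}$ and a time $t\in[\varepsilon,1]$, returns a pair $(i,j)$ with $i\in A$, $j\in U$, $A-i+j\in\mathcal{B}$; $p_{(i,j)}(t,A)$ denotes the probability it returns $(i,j)$. It is right continuous if $t\mapsto p_{(i,j)}(t,A)$ is right continuous on $[\varepsilon,1]$ for all $A,i,j$. Fix an optimal base $O\in\arg\max\{f(S):S\in\mathcal{B}\}$. The procedure is above-average if for all $A\in\mathcal{B}$, $t\in[\varepsilon,1]$: $\mathbb{E}_{(i,j)\sim\mathrm{swap}(t,A)}[\nabla_jF(t\mathbf{1}_A)-\nabla_iF(t\mathbf{1}_A)]\ge\frac1k\big(\sum_{o\in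 O}\nabla_oF(t\mathbf{1}_A)-\sum_{a\in A}\nabla_aF(t\mathbf{1}_A)\big)$. Greedy Swap Poisson Process: start at $t=\varepsilon$ with an arbitrary base $A$; simulate a non-homogeneous Poisson process with rate $\lambda(t)=k/t$; at each event time $t<1$ call $(i,j)\leftarrow\mathrm{swap}(t,A)$ (with fresh randomness) and set $A\leftarrow A-i+j$; when the next event time is $\ge1$, return $A$. *)

theory Defs
  imports "HOL-Probability.Probability"
begin

locale matroid =
  fixes U :: "'a set" and indep :: "'a set set"
  assumes finite_ground: "finite U"
    and indep_subset: "S \<in> indep \<Longrightarrow> S \<subseteq> U"
    and indep_empty: "{} \<in> indep"
    and indep_hereditary: "T \<in> indep \<Longrightarrow> S \<subseteq> T \<Longrightarrow> S \<in> indep"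
    and indep_augment: "S \<in> indep \<Longrightarrow> T \<in> indep \<Longrightarrow> card S < card T \<Longrightarrow>
      \<exists>x\<in>T - S. insert x S \<in> indep"

definition bases :: "'a set set \<Rightarrow> 'a set set" where
  "bases indep = {B \<in> indep. \<forall>S\<in>indep. B \<subseteq> S \<longrightarrow> S = B}"

definition matroid_rank :: "'a set set \<Rightarrow> nat" where
  "matroid_rank indep = Max (card ` indep)"

definition monotone_set_fun :: "'a set \<Rightarrow> ('a set \<Rightarrow> real) \<Rightarrow> bool" where
  "monotone_set_fun U f \<longleftrightarrow> (\<forall>S T. S \<subseteq> T \<and> T \<subseteq> U \<longrightarrow> f S \<le> f T)"

definition submodular :: "'a set \<Rightarrow> ('a set \<Rightarrow> real) \<Rightarrow> bool" where
  "submodular U f \<longleftrightarrow> (\<forall>S T i. S \<subseteq> T \<and> T \<subseteq> U \<and> i \<in> U - T \<longrightarrow>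
     f (insert i S) - f S \<ge> f (insert i T) - f T)"

definition multilinear_ext :: "'a set \<Rightarrow> ('a set \<Rightarrow> real) \<Rightarrow> ('a \<Rightarrow> real) \<Rightarrow> real" where
  "multilinear_ext U f x = (\<Sum>S\<in>Pow U. f S * (\<Prod>i\<in>S. x i) * (\<Prod>i\<in>U - S. 1 - x i))"

definition partial_deriv :: "'a \<Rightarrow> (('a \<Rightarrow> real) \<Rightarrow> real) \<Rightarrow> ('a \<Rightarrow> real) \<Rightarrow> real" where
  "partial_deriv i F x = deriv (\<lambda>s. F (x(i := s))) (x i)"

definition grad :: "'a set \<Rightarrow> ('a set \<Rightarrow> real) \<Rightarrow> real \<Rightarrow> 'a set \<Rightarrow> 'a \<Rightarrow> real" where
  "grad U f t A i = partial_deriv i (multilinear_ext U f) (\<lambda>u. t * indicator A u)"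

definition exchange :: "'a set \<Rightarrow> 'a \<times> 'a \<Rightarrow> 'a set" where
  "exchange A = (\<lambda>(i, j). insert j (A - {i}))"

text \<open>A randomized swap procedure is represented by the output distribution of each call:
  \<open>pmf (swap t A) (i, j)\<close> is the probability that the call with arguments \<open>t\<close> and \<open>A\<close>
  returns \<open>(i, j)\<close>.\<close>

definition swap_procedure ::
  "'a set \<Rightarrow> 'a set set \<Rightarrow> real \<Rightarrow> (real \<Rightarrow> 'a set \<Rightarrow> ('a \<times> 'a) pmf) \<Rightarrow> bool" where
  "swap_procedure U indep \<epsilon> swap \<longleftrightarrow>
     (\<forall>A\<in>bases indep. \<forall>t\<in>{\<epsilon>..1}. \<forall>(i, j)\<in>set_pmf (swap t A).
        i \<in> A \<and> j \<in> U \<and> exchange A (i, j) \<in> bases indep)"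

definition right_continuous_swap ::
  "'a set \<Rightarrow> 'a set set \<Rightarrow> real \<Rightarrow> (real \<Rightarrow> 'a set \<Rightarrow> ('a \<times> 'a) pmf) \<Rightarrow> bool" where
  "right_continuous_swap U indep \<epsilon> swap \<longleftrightarrow>
     (\<forall>A\<in>bases indep. \<forall>i\<in>U. \<forall>j\<in>U. \<forall>t\<in>{\<epsilon>..1}.
        continuous (at t within {t..1}) (\<lambda>s. pmf (swap s A) (i, j)))"

definition above_average ::
  "'a set \<Rightarrow> 'a set set \<Rightarrow> ('a set \<Rightarrow> real) \<Rightarrow> 'a set \<Rightarrow> real \<Rightarrow>
    (real \<Rightarrow> 'a set \<Rightarrow> ('a \<times> 'a) pmf) \<Rightarrow> bool" where
  "above_average U indep f Opt \<epsilon> swap \<longleftrightarrow>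
     (\<forall>A\<in>bases indep. \<forall>t\<in>{\<epsilon>..1}.
        measure_pmf.expectation (swap t A) (\<lambda>(i, j). grad U f t A j - grad U f t A i)
          \<ge> 1 / real (matroid_rank indep) *
             ((\<Sum>b\<in>Opt. grad U f t A b) - (\<Sum>a\<in>A. grad U f t A a)))"

definition num_events :: "(nat \<Rightarrow> 'w \<Rightarrow> real) \<Rightarrow> real \<Rightarrow> real \<Rightarrow> 'w \<Rightarrow> nat" where
  "num_events T s t w = card {n. s < T n w \<and> T n w \<le> t}"

text \<open>\<open>T 0 < T 1 < \<dots>\<close> are the event times, after the start time \<open>a\<close>. The process is assumed
  to have infinitely many events in total, as is the case almost surely if \<open>rate\<close> has infinite
  integral over the half-line from \<open>a\<close>. Divergence of the event times excludes
  infinitely many events in a bounded interval, where \<open>card\<close> would be \<open>0\<close>.\<close>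

locale nonhom_poisson_process = prob_space M
  for M :: "'w measure" +
  fixes rate :: "real \<Rightarrow> real" and a :: real and T :: "nat \<Rightarrow> 'w \<Rightarrow> real"
  assumes times_rv: "\<And>n. random_variable borel (T n)"
    and times_ordered: "AE w in M. a < T 0 w \<and> strict_mono (\<lambda>n. T n w)"
    and times_diverge: "AE w in M. filterlim (\<lambda>n. T n w) at_top sequentially"
    and poisson_increments: "\<And>s t n. a \<le> s \<Longrightarrow> s \<le> t \<Longrightarrow>
      prob {w \<in> space M. num_events T s t w = n}
        = (integral {s..t} rate) ^ n / fact n * exp (- integral {s..t} rate)"
    and independent_increments: "\<And>t :: nat \<Rightarrow> real. a \<le> t 0 \<Longrightarrow> mono t \<Longrightarrow>
      indep_vars (\<lambda>_. count_space UNIV) (\<lambda>i. num_events T (t i) (t (Suc i))) UNIV"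

text \<open>The base held after the first \<open>n\<close> swaps, where \<open>X m\<close> is the pair returned by
  the call number \<open>m\<close>, counting from \<open>0\<close>.\<close>

primrec current_base :: "'a set \<Rightarrow> (nat \<Rightarrow> 'w \<Rightarrow> 'a \<times> 'a) \<Rightarrow> nat \<Rightarrow> 'w \<Rightarrow> 'a set" where
  "current_base A\<^sub>0 X 0 w = A\<^sub>0"
| "current_base A\<^sub>0 X (Suc n) w = exchange (current_base A\<^sub>0 X n w) (X n w)"

text \<open>The sigma-algebra generated by all event times and by the results of the calls before
  call \<open>n\<close>.\<close>

definition history ::
  "'w measure \<Rightarrow> (nat \<Rightarrow> 'w \<Rightarrow> real) \<Rightarrow> (nat \<Rightarrow> 'w \<Rightarrow> 'a \<times> 'a) \<Rightarrow> nat \<Rightarrow> 'w measure" where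
  "history M T X n = sigma (space M)
     ({T m -` B \<inter> space M | m B. B \<in> sets borel} \<union> {X m -` {p} \<inter> space M | m p. m < n})"

text \<open>A run of the algorithm on an arbitrary probability space. The assumption \<open>fresh_swaps\<close>
  says that every call made (that is, at an event time before \<open>1\<close>) uses fresh randomness: given
  the whole Poisson process and the results of the earlier calls, its result has distribution
  \<open>swap t A\<close>, for the current time \<open>t\<close> and base \<open>A\<close>. The values \<open>X n\<close> for event times
  from \<open>1\<close> on are irrelevant dummies in \<open>U \<times> U\<close>.\<close>

locale greedy_swap_poisson_process =
  nonhom_poisson_process M "\<lambda>t. real (matroid_rank indep) / t" \<epsilon> T
  for M :: "'w measure" and U :: "'a set" and indep :: "'a set set" and \<epsilon> :: real
    and swap :: "real \<Rightarrow> 'a set \<Rightarrow> ('a \<times> 'a) pmf" and A\<^sub>0 :: "'a set"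
    and T :: "nat \<Rightarrow> 'w \<Rightarrow> real" and X :: "nat \<Rightarrow> 'w \<Rightarrow> 'a \<times> 'a" +
  assumes initial_base: "A\<^sub>0 \<in> bases indep"
    and swaps_rv: "\<And>n. random_variable (count_space (U \<times> U)) (X n)"
    and fresh_swaps: "\<And>n p. p \<in> U \<times> U \<Longrightarrow>
      AE w in M. T n w < 1 \<longrightarrow>
        real_cond_exp M (history M T X n) (\<lambda>w. indicator {p} (X n w)) w
          = pmf (swap (T n w) (current_base A\<^sub>0 X n w)) p"

text \<open>The algorithm stops at the first event time that is at least \<open>1\<close>; since calls are numbered
  from \<open>0\<close>, the index of that event is the number of calls made.\<close>

definition num_calls :: "(nat \<Rightarrow> 'w \<Rightarrow> real) \<Rightarrow> 'w \<Rightarrow> nat" where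
  "num_calls T w = (LEAST n. T n w \<ge> 1)"

definition returned_base ::
  "'a set \<Rightarrow> (nat \<Rightarrow> 'w \<Rightarrow> real) \<Rightarrow> (nat \<Rightarrow> 'w \<Rightarrow> 'a \<times> 'a) \<Rightarrow> 'w \<Rightarrow> 'a set" where
  "returned_base A\<^sub>0 T X w = current_base A\<^sub>0 X (num_calls T w) w"

end

theory Submission
  imports Defs
begin

text \<open>Let \<open>\<phi> t\<close> be the expectation of the multilinear extension \<open>F\<close> at \<open>t\<close> times the indicator of
  the base held at time \<open>t\<close>. Growing \<open>t\<close> contributes the derivatives of \<open>F\<close> along the current base \<open>A\<close>,
  while swaps, which happen at rate \<open>k / t\<close> and gain at least \<open>t / k\<close> times the difference of the
  derivative sums over \<open>Opt\<close> and over \<open>A\<close>, trade them for the derivatives along \<open>Opt\<close>; the latter sum to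
  at least \<open>f Opt - F\<close>. Hence \<open>\<phi>' \<ge> f Opt - \<phi>\<close>, so \<open>\<phi> 1 \<ge> (1 - exp (\<epsilon> - 1)) * f Opt\<close>, and concavity gives
  the claimed factor. The differential inequality is used in the form of a bound on \<open>\<phi> u\<close> in terms
  of \<open>\<phi> t\<close> with error \<open>O((u - t)\<^sup>2)\<close>, obtained by conditioning on whether \<open>(t, u]\<close> contains
  no event or one event (two or more contribute a nonnegative term), and summed over finer and finer
  partitions. Right continuity of the swap probabilities enters through their measurability in time.\<close>

section \<open>The multilinear extension\<close>

text \<open>The one-step bound needs the base held at time \<open>t\<close> to be independent of the
  number of events in \<open>(t, u]\<close>. This is not immediate: \<open>fresh_swaps\<close>
  conditions each call on all event times, later ones included. The way out is that the law of call
  \<open>n\<close> reads only \<open>T n\<close> and the current base. Integrating out the calls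
  from the last to the first leaves weights that depend on event times up to \<open>t\<close> alone,
  and for these the independent increments of the counting process suffice.

  The second obstacle is that the procedure may behave very differently at nearby times. Hence
  nothing is compared between \<open>swap s A\<close> and \<open>swap t A\<close>. The above-average
  inequality is applied at the actual event time \<open>s\<close>, and only its right-hand side, a
  polynomial in \<open>s\<close> for fixed sets, is moved from \<open>s\<close> to \<open>t\<close>.
  As there are finitely many sets, one Lipschitz constant serves all of them and makes the local
  error uniform.\<close>

lemma multilinear_ext_insert:
  assumes "finite V" "i \<notin> V"
  shows "multilinear_ext (insert i V) g x =
    x i * multilinear_ext V (\<lambda>S. g (insert i S)) x + (1 - x i) * multilinear_ext V g x"
proof -
  have inj: "inj_on (insert i) (Pow V)" using assms(2) by (force simp: inj_on_def)
  have 1: "g (insert i S) * (\<Prod>j\<in>insert i S. x j) * (\<Prod>j\<in>insert i V - insert i S. 1 - x j)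
     = x i * (g (insert i S) * (\<Prod>j\<in>S. x j) * (\<Prod>j\<in>V - S. 1 - x j))" if "S \<in> Pow V" for S
  proof -
    have "finite S" "i \<notin> S" "insert i V - insert i S = V - S"
      using that assms finite_subset by auto
    then show ?thesis by simp
  qed
  have 2: "g S * (\<Prod>j\<in>S. x j) * (\<Prod>j\<in>insert i V - S. 1 - x j)
     = (1 - x i) * (g S * (\<Prod>j\<in>S. x j) * (\<Prod>j\<in>V - S. 1 - x j))" if "S \<in> Pow V" for S
  proof -
    have "insert i V - S = insert i (V - S)" using that assms by auto
    then show ?thesis using assms by simp
  qed
  have "multilinear_ext (insert i V) g x
    = (\<Sum>S\<in>Pow V. g S * (\<Prod>j\<in>S. x j) * (\<Prod>j\<in>insert i V - S. 1 - x j))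
    + (\<Sum>S\<in>insert i ` Pow V. g S * (\<Prod>j\<in>S. x j) * (\<Prod>j\<in>insert i V - S. 1 - x j))"
    unfolding multilinear_ext_def Pow_insert
    by (rule sum.union_disjoint) (use assms in auto)
  also have "(\<Sum>S\<in>insert i ` Pow V. g S * (\<Prod>j\<in>S. x j) * (\<Prod>j\<in>insert i V - S. 1 - x j))
     = x i * multilinear_ext V (\<lambda>S. g (insert i S)) x"
    unfolding multilinear_ext_def sum.reindex[OF inj] sum_distrib_left comp_def
    by (rule sum.cong[OF refl], rule 1)
  also have "(\<Sum>S\<in>Pow V. g S * (\<Prod>j\<in>S. x j) * (\<Prod>j\<in>insert i V - S. 1 - x j))
     = (1 - x i) * multilinear_ext V g x"
    unfolding multilinear_ext_def sum_distrib_left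
    by (rule sum.cong[OF refl], rule 2)
  finally show ?thesis by simp
qed

lemma multilinear_ext_cong:
  assumes "\<And>i. i \<in> V \<Longrightarrow> x i = y i" and "\<And>S. S \<subseteq> V \<Longrightarrow> g S = h S"
  shows "multilinear_ext V g x = multilinear_ext V h y"
  unfolding multilinear_ext_def
proof (rule sum.cong[OF refl])
  fix S assume S: "S \<in> Pow V"
  have "(\<Prod>i\<in>S. x i) = (\<Prod>i\<in>S. y i)" "(\<Prod>i\<in>V - S. 1 - x i) = (\<Prod>i\<in>V - S. 1 - y i)"
    using S assms(1) by (auto intro!: prod.cong)
  then show "g S * (\<Prod>i\<in>S. x i) * (\<Prod>i\<in>V - S. 1 - x i) = h S * (\<Prod>i\<in>S. y i) * (\<Prod>i\<in>V - S. 1 - y i)"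
    using S assms(2) by simp
qed

lemma multilinear_ext_diff:
  "multilinear_ext V g x - multilinear_ext V h x = multilinear_ext V (\<lambda>S. g S - h S) x"
  unfolding multilinear_ext_def by (simp add: sum_subtractf algebra_simps)

lemma multilinear_ext_le:
  assumes "\<And>i. i \<in> V \<Longrightarrow> 0 \<le> x i \<and> x i \<le> 1" and "\<And>S. S \<subseteq> V \<Longrightarrow> g S \<le> h S"
  shows "multilinear_ext V g x \<le> multilinear_ext V h x"
  unfolding multilinear_ext_def
proof (rule sum_mono)
  fix S assume S: "S \<in> Pow V"
  have "0 \<le> (\<Prod>i\<in>S. x i)" "0 \<le> (\<Prod>i\<in>V - S. 1 - x i)"
    using S assms(1) by (auto intro!: prod_nonneg)
  then show "g S * (\<Prod>i\<in>S. x i) * (\<Prod>i\<in>V - S. 1 - x i) \<le> h S * (\<Prod>i\<in>S. x i) * (\<Prod>i\<in>V - S. 1 - x i)"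
    using S assms(2) by (auto intro!: mult_right_mono)
qed

lemma multilinear_ext_nonneg:
  assumes "\<And>i. i \<in> V \<Longrightarrow> 0 \<le> x i \<and> x i \<le> 1" and "\<And>S. S \<subseteq> V \<Longrightarrow> 0 \<le> g S"
  shows "0 \<le> multilinear_ext V g x"
  using multilinear_ext_le[of V x "\<lambda>_. 0" g] assms by (simp add: multilinear_ext_def)

lemma multilinear_ext_mono:
  assumes "finite V" and "monotone_set_fun V g"
    and "\<And>i. i \<in> V \<Longrightarrow> 0 \<le> x i \<and> x i \<le> y i \<and> y i \<le> 1"
  shows "multilinear_ext V g x \<le> multilinear_ext V g y"
  using assms
proof (induction V arbitrary: g rule: finite_induct)
  case empty
  then show ?case by (simp add: multilinear_ext_def)
next
  case (insert i V)
  let ?h = "\<lambda>S. g (insert i S)"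
  have m: "g S \<le> g S'" if "S \<subseteq> S'" "S' \<subseteq> insert i V" for S S'
    using insert.prems(1) that unfolding monotone_set_fun_def by blast
  have 1: "monotone_set_fun V g"
    unfolding monotone_set_fun_def using m by blast
  have 2: "monotone_set_fun V ?h"
    unfolding monotone_set_fun_def by (intro allI impI m) auto
  have I: "multilinear_ext V g x \<le> multilinear_ext V g y"
    "multilinear_ext V ?h x \<le> multilinear_ext V ?h y"
    using insert.IH[OF 1] insert.IH[OF 2] insert.prems(2) by auto
  \<comment> \<open>Since the part with \<open>i\<close> dominates the part without it, shifting
    weight towards the former, from \<open>x i\<close> to \<open>y i\<close>, can only increase the
    mixture.\<close>
  have c: "multilinear_ext V g y \<le> multilinear_ext V ?h y"
    by (rule multilinear_ext_le) (use insert.prems(2) in \<open>force intro!: m\<close>)+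
  have xi: "0 \<le> x i" "x i \<le> y i" "y i \<le> 1" using insert.prems(2) by auto
  have "multilinear_ext (insert i V) g x
     \<le> x i * multilinear_ext V ?h y + (1 - x i) * multilinear_ext V g y"
    unfolding multilinear_ext_insert[OF insert.hyps]
    by (intro add_mono mult_left_mono I) (use xi in auto)
  also have "\<dots> = multilinear_ext V g y + x i * (multilinear_ext V ?h y - multilinear_ext V g y)"
    by (simp add: algebra_simps)
  also have "\<dots> \<le> multilinear_ext V g y + y i * (multilinear_ext V ?h y - multilinear_ext V g y)"
    using xi c by (intro add_left_mono mult_right_mono) auto
  also have "\<dots> = multilinear_ext (insert i V) g y"
    unfolding multilinear_ext_insert[OF insert.hyps] by (simp add: algebra_simps)
  finally show ?case .
qed

section \<open>Partial derivatives of the multilinear extension\<close>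

definition marginal_ext :: "'a set \<Rightarrow> ('a set \<Rightarrow> real) \<Rightarrow> 'a \<Rightarrow> ('a \<Rightarrow> real) \<Rightarrow> real" where
  "marginal_ext U f i = multilinear_ext (U - {i}) (\<lambda>S. f (insert i S) - f S)"

text \<open>Conditioning on whether \<open>i\<close> lies in the random set shows that the extension
  is affine in coordinate \<open>i\<close>, with slope \<open>marginal_ext U f i\<close>. Being an
  extension over \<open>U - {i}\<close>, the slope does not see coordinate \<open>i\<close> and may
  be evaluated before or after that coordinate moves.\<close>

lemma multilinear_ext_upd:
  assumes "finite U" "i \<in> U"
  shows "multilinear_ext U f (x(i := s)) = multilinear_ext (U - {i}) f x + s * marginal_ext U f i x"
proof -
  have U: "U = insert i (U - {i})" using assms by auto
  have "multilinear_ext U f (x(i := s)) =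
    s * multilinear_ext (U - {i}) (\<lambda>S. f (insert i S)) (x(i := s)) + (1 - s) * multilinear_ext (U - {i}) f (x(i := s))"
    by (subst U, subst multilinear_ext_insert) (use assms in auto)
  also have "multilinear_ext (U - {i}) (\<lambda>S. f (insert i S)) (x(i := s)) = multilinear_ext (U - {i}) (\<lambda>S. f (insert i S)) x"
    by (rule multilinear_ext_cong) auto
  also have "multilinear_ext (U - {i}) f (x(i := s)) = multilinear_ext (U - {i}) f x"
    by (rule multilinear_ext_cong) auto
  finally have "multilinear_ext U f (x(i := s)) =
    s * multilinear_ext (U - {i}) (\<lambda>S. f (insert i S)) x + (1 - s) * multilinear_ext (U - {i}) f x" .
  moreover have "marginal_ext U f i x =
      multilinear_ext (U - {i}) (\<lambda>S. f (insert i S)) x - multilinear_ext (U - {i}) f x"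
    unfolding marginal_ext_def multilinear_ext_diff ..
  ultimately show ?thesis by (simp only: ring_distribs)
qed

lemma multilinear_ext_upd_diff:
  assumes "finite U" "i \<in> U"
  shows "multilinear_ext U f (x(i := s)) - multilinear_ext U f (x(i := r)) = (s - r) * marginal_ext U f i x"
  unfolding multilinear_ext_upd[OF assms] by (simp add: algebra_simps)

lemma partial_deriv_multilinear_ext:
  assumes "finite U" "i \<in> U"
  shows "partial_deriv i (multilinear_ext U f) x = marginal_ext U f i x"
proof -
  have "((\<lambda>s. multilinear_ext (U - {i}) f x + s * marginal_ext U f i x) has_real_derivative
      marginal_ext U f i x) (at (x i))"
    by (auto intro!: derivative_eq_intros)
  then show ?thesis
    unfolding partial_deriv_def multilinear_ext_upd[OF assms] by (rule DERIV_imp_deriv)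
qed

lemma marginal_ext_nonneg:
  assumes "monotone_set_fun U f" "i \<in> U" "\<And>j. j \<in> U \<Longrightarrow> 0 \<le> x j \<and> x j \<le> 1"
  shows "0 \<le> marginal_ext U f i x"
proof -
  have "f S \<le> f (insert i S)" if "S \<subseteq> U - {i}" for S
    using assms(1,2) that unfolding monotone_set_fun_def by (metis Diff_subset insert_subset subset_insertI subset_trans)
  then show ?thesis
    unfolding marginal_ext_def by (intro multilinear_ext_nonneg) (use assms in auto)
qed

text \<open>Submodularity says that the negated marginal of \<open>i\<close> is a monotone set
  function on \<open>U - {i}\<close>, so its extension is monotone in the point.\<close>

lemma marginal_ext_antimono:
  assumes "finite U" "submodular U f" "i \<in> U" "\<And>j. j \<in> U \<Longrightarrow> 0 \<le> x j \<and> x j \<le> y j \<and> y j \<le> 1"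
  shows "marginal_ext U f i y \<le> marginal_ext U f i x"
proof -
  let ?g = "\<lambda>S. f S - f (insert i S)"
  have "f S - f (insert i S) \<le> f T - f (insert i T)" if "S \<subseteq> T" "T \<subseteq> U - {i}" for S T
  proof -
    have "f (insert i S) - f S \<ge> f (insert i T) - f T"
      using assms(2,3) that unfolding submodular_def by blast
    then show ?thesis by simp
  qed
  then have "monotone_set_fun (U - {i}) ?g" unfolding monotone_set_fun_def by blast
  then have "multilinear_ext (U - {i}) ?g x \<le> multilinear_ext (U - {i}) ?g y"
    by (intro multilinear_ext_mono) (use assms in auto)
  moreover have "marginal_ext U f i z = - multilinear_ext (U - {i}) ?g z" for z
    unfolding marginal_ext_def multilinear_ext_def sum_negf[symmetric]
    by (rule sum.cong) (auto simp: algebra_simps)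
  ultimately show ?thesis by simp
qed

text \<open>The coordinates in \<open>D\<close> are raised one at a time. Each rise is its length
  times a slope at an intermediate point above \<open>x\<close>, and slopes decrease upwards, so the
  slope at \<open>x\<close> is an upper bound.\<close>

lemma multilinear_ext_increment_le:
  assumes U: "finite U" "submodular U f" and D: "finite D" "D \<subseteq> U"
    and xy: "\<And>j. j \<in> U \<Longrightarrow> 0 \<le> x j \<and> x j \<le> y j \<and> y j \<le> 1"
    and eq: "\<And>j. j \<in> U - D \<Longrightarrow> y j = x j"
  shows "multilinear_ext U f y - multilinear_ext U f x \<le> (\<Sum>d\<in>D. (y d - x d) * marginal_ext U f d x)"
  using D xy eq
proof (induction D arbitrary: y rule: finite_induct)
  case empty
  then have "multilinear_ext U f y = multilinear_ext U f x" by (intro multilinear_ext_cong) auto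
  then show ?case by simp
next
  case (insert d D)
  let ?y = "y(d := x d)"
  have d: "d \<in> U" using insert.prems by auto
  have IH: "multilinear_ext U f ?y - multilinear_ext U f x \<le> (\<Sum>e\<in>D. (?y e - x e) * marginal_ext U f e x)"
    by (rule insert.IH) (use insert.prems in force)+
  have s: "(\<Sum>e\<in>D. (?y e - x e) * marginal_ext U f e x) = (\<Sum>e\<in>D. (y e - x e) * marginal_ext U f e x)"
    using insert.hyps by (intro sum.cong) auto
  have "multilinear_ext U f y - multilinear_ext U f ?y = (y d - x d) * marginal_ext U f d ?y"
    using multilinear_ext_upd_diff[OF U(1) d, of f ?y "y d" "x d"] by simp
  also have "\<dots> \<le> (y d - x d) * marginal_ext U f d x"
    by (intro mult_left_mono marginal_ext_antimono U d) (use insert.prems d in force)+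
  finally show ?case using IH s insert.hyps by simp
qed

text \<open>Mirror image of the upper bound: all intermediate points lie below \<open>y\<close>, so
  the slopes at \<open>y\<close> are the smallest.\<close>

lemma multilinear_ext_increment_ge:
  assumes U: "finite U" "submodular U f" and D: "finite D" "D \<subseteq> U"
    and xy: "\<And>j. j \<in> U \<Longrightarrow> 0 \<le> x j \<and> x j \<le> y j \<and> y j \<le> 1"
    and eq: "\<And>j. j \<in> U - D \<Longrightarrow> y j = x j"
  shows "(\<Sum>d\<in>D. (y d - x d) * marginal_ext U f d y) \<le> multilinear_ext U f y - multilinear_ext U f x"
  using D xy eq
proof (induction D arbitrary: x rule: finite_induct)
  case empty
  then have "multilinear_ext U f y = multilinear_ext U f x" by (intro multilinear_ext_cong) auto
  then show ?case by simp
next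
  case (insert d D)
  let ?x = "x(d := y d)"
  have d: "d \<in> U" using insert.prems by auto
  have IH: "(\<Sum>e\<in>D. (y e - ?x e) * marginal_ext U f e y) \<le> multilinear_ext U f y - multilinear_ext U f ?x"
    by (rule insert.IH) (use insert.prems in force)+
  have s: "(\<Sum>e\<in>D. (y e - ?x e) * marginal_ext U f e y) = (\<Sum>e\<in>D. (y e - x e) * marginal_ext U f e y)"
    using insert.hyps by (intro sum.cong) auto
  have "(y d - x d) * marginal_ext U f d y \<le> (y d - x d) * marginal_ext U f d ?x"
    by (intro mult_left_mono marginal_ext_antimono U d) (use insert.prems d in force)+
  also have "\<dots> = multilinear_ext U f ?x - multilinear_ext U f x"
    using multilinear_ext_upd_diff[OF U(1) d, of f ?x "y d" "x d"] by simp
  finally show ?case using IH s insert.hyps by simp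
qed

lemma multilinear_ext_indicator:
  assumes "finite U" "A \<subseteq> U"
  shows "multilinear_ext U f (indicator A) = f A"
proof -
  have z: "f S * (\<Prod>i\<in>S. indicator A i) * (\<Prod>i\<in>U - S. 1 - indicator A i) = (if S = A then f A else (0::real))"
    if "S \<in> Pow U" for S
  proof (cases "S = A")
    case True
    have "(\<Prod>i\<in>A. indicator A i) = (1::real)" "(\<Prod>i\<in>U - A. 1 - indicator A i) = (1::real)"
      by (auto intro!: prod.neutral)
    then show ?thesis using True by simp
  next
    case False
    then consider i where "i \<in> S" "i \<notin> A" | i where "i \<in> U - S" "i \<in> A"
      using that assms by blast
    then show ?thesis
    proof cases
      case 1
      then have "(\<Prod>i\<in>S. indicator A i) = (0::real)"
        using that assms finite_subset by (intro prod_zero) (auto intro!: bexI[of _ i])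
      then show ?thesis using False by simp
    next
      case 2
      then have "(\<Prod>i\<in>U - S. 1 - indicator A i) = (0::real)"
        using assms by (intro prod_zero) (auto intro!: bexI[of _ i])
      then show ?thesis using False by simp
    qed
  qed
  have "multilinear_ext U f (indicator A) = (\<Sum>S\<in>Pow U. if S = A then f A else 0)"
    unfolding multilinear_ext_def by (rule sum.cong[OF refl z])
  also have "\<dots> = f A" using assms by (simp add: sum.delta)
  finally show ?thesis .
qed

text \<open>Raising all coordinates in \<open>B\<close> to 1 gives a point above the indicator of
  \<open>B\<close>, hence a value of at least \<open>f B\<close>; the rise costs at most the slopes
  at \<open>x\<close>, as each coordinate moves by at most 1.\<close>

lemma marginal_ext_sum_ge:
  assumes U: "finite U" "submodular U f" "monotone_set_fun U f" and B: "B \<subseteq> U"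
    and x: "\<And>j. j \<in> U \<Longrightarrow> 0 \<le> x j \<and> x j \<le> 1"
  shows "f B - multilinear_ext U f x \<le> (\<Sum>b\<in>B. marginal_ext U f b x)"
proof -
  define y where "y j = (if j \<in> B then 1 else x j)" for j
  have "f B \<le> multilinear_ext U f y"
    unfolding multilinear_ext_indicator[OF U(1) B, of f, symmetric]
    by (rule multilinear_ext_mono[OF U(1,3)]) (use x in \<open>auto simp: y_def indicator_def\<close>)
  moreover have "multilinear_ext U f y - multilinear_ext U f x \<le> (\<Sum>b\<in>B. (y b - x b) * marginal_ext U f b x)"
    by (rule multilinear_ext_increment_le[OF U(1,2)])
      (use finite_subset[OF B U(1)] B x in \<open>auto simp: y_def\<close>)
  moreover have "\<dots> \<le> (\<Sum>b\<in>B. 1 * marginal_ext U f b x)"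
    by (intro sum_mono mult_right_mono marginal_ext_nonneg U) (use x B in \<open>auto simp: y_def\<close>)
  ultimately show ?thesis by simp
qed

section \<open>Polynomial dependence on the time parameter\<close>

lemma multilinear_ext_poly:
  fixes q :: "'a \<Rightarrow> real poly"
  shows "\<exists>p. \<forall>t. multilinear_ext V g (\<lambda>i. poly (q i) t) = poly p t"
proof (intro exI allI)
  fix t
  show "multilinear_ext V g (\<lambda>i. poly (q i) t) =
    poly (\<Sum>S\<in>Pow V. smult (g S) ((\<Prod>i\<in>S. q i) * (\<Prod>i\<in>V - S. 1 - q i))) t"
    by (simp add: multilinear_ext_def poly_sum poly_prod mult.assoc)
qed

abbreviation scaled_indicator :: "'a set \<Rightarrow> real \<Rightarrow> 'a \<Rightarrow> real" where
  "scaled_indicator A t \<equiv> \<lambda>u. t * indicator A u"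

text \<open>Source of all bounds and Lipschitz constants in time: on \<open>[0, 1]\<close> a
  polynomial is bounded and Lipschitz.\<close>

lemma multilinear_ext_scaled_indicator_poly:
  "\<exists>p. \<forall>t. multilinear_ext V g (scaled_indicator A t) = poly p t"
  using multilinear_ext_poly[of V g "\<lambda>u. [:0, indicator A u:]"] by simp

lemma poly_lipschitz:
  fixes p :: "real poly"
  shows "\<exists>C\<ge>0. \<forall>x\<in>{0..1}. \<forall>y\<in>{0..1}. \<bar>poly p x - poly p y\<bar> \<le> C * \<bar>x - y\<bar>"
proof -
  have "compact (poly (pderiv p) ` {0..1::real})"
    by (intro compact_continuous_image continuous_intros) auto
  then obtain C where C: "\<And>z. z \<in> {0..1} \<Longrightarrow> \<bar>poly (pderiv p) z\<bar> \<le> C"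
    by (force dest!: compact_imp_bounded simp: bounded_iff)
  have *: "\<bar>poly p y - poly p x\<bar> \<le> C * \<bar>y - x\<bar>" if xy: "x \<in> {0..1}" "y \<in> {0..1}" "x < y" for x y
  proof -
    obtain z where z: "x < z" "z < y" "poly p y - poly p x = (y - x) * poly (pderiv p) z"
      using poly_MVT[OF xy(3)] by blast
    then show ?thesis using C[of z] xy
      by (simp add: abs_mult mult.commute[of C] mult_left_mono)
  qed
  show ?thesis
  proof (intro exI conjI ballI)
    show "0 \<le> C" using C[of 0] by (simp add: abs_ge_zero order_trans[OF abs_ge_zero])
    fix x y :: real assume "x \<in> {0..1}" "y \<in> {0..1}"
    then show "\<bar>poly p x - poly p y\<bar> \<le> C * \<bar>x - y\<bar>"
      using *[of x y] *[of y x] by (cases x y rule: linorder_cases) (auto simp: abs_minus_commute)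
  qed
qed

section \<open>Poisson processes\<close>

context
  fixes T :: "nat \<Rightarrow> 'w \<Rightarrow> real" and a :: real and w :: 'w
  assumes start: "a < T 0 w" and mono: "strict_mono (\<lambda>n. T n w)"
    and diverge: "filterlim (\<lambda>n. T n w) at_top sequentially"
begin

lemma events_finite: "finite {n. T n w \<le> t}"
proof -
  obtain n where "t < T n w"
    using diverge by (auto simp: filterlim_at_top_dense eventually_sequentially)
  then have "{n. T n w \<le> t} \<subseteq> {..<n}"
    using strict_mono_less_eq[OF mono, of n] by (force simp: not_less[symmetric])
  then show ?thesis by (rule finite_subset) simp
qed

lemma start_less: "a < T n w"
  using start strict_mono_less_eq[OF mono, of 0 n] by simp

text \<open>The indices of the events up to \<open>t\<close> form an initial segment, finite by
  divergence, so its cardinality is the first index beyond \<open>t\<close>. This is the dictionary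
  between counts and event times.\<close>

lemma less_num_events_iff: "m < num_events T a t w \<longleftrightarrow> T m w \<le> t"
proof -
  define N where "N = (LEAST n. t < T n w)"
  obtain n where "t < T n w"
    using diverge by (auto simp: filterlim_at_top_dense eventually_sequentially)
  then have N: "t < T N w" unfolding N_def by (rule LeastI)
  have *: "T m w \<le> t \<longleftrightarrow> m < N" for m
    using N not_less_Least[of m "\<lambda>n. t < T n w"] strict_mono_less_eq[OF mono, of N m]
    unfolding N_def[symmetric] by force
  have "{n. a < T n w \<and> T n w \<le> t} = {..<N}"
    using start_less * by auto
  then show ?thesis unfolding num_events_def * by simp
qed

lemma num_events_eq_iff: "num_events T a t w = n \<longleftrightarrow> (\<forall>m<n. T m w \<le> t) \<and> \<not> T n w \<le> t"
  unfolding less_num_events_iff[symmetric] using linorder_neqE_nat by blast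

lemma num_events_add:
  assumes "a \<le> s" "s \<le> t"
  shows "num_events T a s w + num_events T s t w = num_events T a t w"
proof -
  have "{n. a < T n w \<and> T n w \<le> t} = {n. a < T n w \<and> T n w \<le> s} \<union> {n. s < T n w \<and> T n w \<le> t}"
    using assms by auto
  then show ?thesis unfolding num_events_def
    by (subst card_Un_disjoint[symmetric])
      (auto intro: finite_subset[OF _ events_finite[of s]] finite_subset[OF _ events_finite[of t]])
qed

end

lemma measurable_num_events [measurable]:
  assumes [measurable]: "\<And>n. T n \<in> borel_measurable N"
  shows "num_events T s t \<in> measurable N (count_space UNIV)"
  unfolding num_events_def [abs_def] by measurable

lemma (in prob_space) poisson_expectation:
  assumes X [measurable]: "random_variable (count_space UNIV) (X :: 'a \<Rightarrow> nat)" and r: "0 \<le> r"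
    and p: "\<And>n. prob {w \<in> space M. X w = n} = r ^ n / fact n * exp (- r)"
  shows "integrable M (\<lambda>w. real (X w))" "expectation (\<lambda>w. real (X w)) = r"
proof -
  let ?p = "\<lambda>n::nat. r ^ n / fact n * exp (- r)"
  have "distr M (count_space UNIV) X = density (count_space UNIV) (\<lambda>n. ennreal (?p n))"
  proof (rule measure_eqI_countable[where A = UNIV])
    fix n :: nat
    have "X -` {n} \<inter> space M = {w \<in> space M. X w = n}" by auto
    then have "emeasure (distr M (count_space UNIV) X) {n} = ennreal (?p n)"
      by (simp add: emeasure_distr emeasure_eq_measure p)
    also have "\<dots> = emeasure (density (count_space UNIV) (\<lambda>n. ennreal (?p n))) {n}"
      by (subst emeasure_density) (auto simp: nn_integral_count_space_indicator one_ennreal_def[symmetric])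
    finally show "emeasure (distr M (count_space UNIV) X) {n} = \<dots>" .
  qed auto
  then have "(\<integral>\<^sup>+w. ennreal (real (X w)) \<partial>M)
      = (\<integral>\<^sup>+n. ennreal (real n) \<partial>density (count_space UNIV) (\<lambda>n. ennreal (?p n)))"
    using nn_integral_distr[OF X, of "\<lambda>n. ennreal (real n)"] by simp
  also have "\<dots> = (\<Sum>n. ennreal (?p n * real n))"
    using r by (simp add: nn_integral_density nn_integral_count_space_nat ennreal_mult'[symmetric])
  also have "\<dots> = ennreal r"
  proof -
    have "(\<lambda>n. r * exp (- r) * (r ^ n /\<^sub>R fact n)) sums (r * exp (- r) * exp r)"
      by (intro sums_mult exp_converges)
    moreover have "r * exp (- r) * exp r = r" by (simp add: exp_minus)
    \<comment> \<open>The factor \<open>Suc n\<close> cancels against the factorial, which shifts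
      the exponential series by one index; the term at 0 vanishes.\<close>
    moreover have "r * exp (- r) * (r ^ n /\<^sub>R fact n) = ?p (Suc n) * real (Suc n)" for n
      by (simp add: field_simps del: of_nat_Suc)
    ultimately have "(\<lambda>n. ?p (Suc n) * real (Suc n)) sums r" by simp
    then have "(\<lambda>n. ?p n * real n) sums r"
      using sums_Suc_iff[of "\<lambda>n. ?p n * real n" r] by simp
    then show ?thesis
      using r by (intro suminf_ennreal_eq) auto
  qed
  finally have "integrable M (\<lambda>w. real (X w)) \<and> expectation (\<lambda>w. real (X w)) = r"
    using nn_integral_eq_integrable[of "\<lambda>w. real (X w)" M r] r by simp
  then show "integrable M (\<lambda>w. real (X w))" "expectation (\<lambda>w. real (X w)) = r" by auto
qed

lemma (in finite_measure) integrable_bounded: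
  fixes g :: "'a \<Rightarrow> real"
  assumes "g \<in> borel_measurable M" "\<And>w. w \<in> space M \<Longrightarrow> \<bar>g w\<bar> \<le> C"
  shows "integrable M g"
  using assms by (intro integrable_const_bound[where B = C]) auto

lemma sigma_sets_vimage_subset:
  assumes "X \<in> measurable F N" "space F = space M"
  shows "sigma_sets (space M) {X -` A \<inter> space M | A. A \<in> sets N} \<subseteq> sets F"
  unfolding assms(2)[symmetric]
  by (rule sets.sigma_sets_subset) (use assms(1) in \<open>auto intro: measurable_sets\<close>)

section \<open>Independence of later counts from the past of the process\<close>

context nonhom_poisson_process
begin

declare times_rv [measurable]

lemma AE_regular: "AE w in M. a < T 0 w \<and> strict_mono (\<lambda>n. T n w) \<and> filterlim (\<lambda>n. T n w) at_top sequentially"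
  using times_ordered times_diverge by eventually_elim auto

lemma AE_less_num_events_iff: "AE w in M. \<forall>m t. m < num_events T a t w \<longleftrightarrow> T m w \<le> t"
  using AE_regular by eventually_elim (auto simp: less_num_events_iff)

lemma AE_start_less: "AE w in M. \<forall>m. a < T m w"
  using AE_regular by eventually_elim (auto intro: start_less)

text \<open>Generator of the natural filtration at time \<open>t\<close>. Finite intersections are
  built in so that the family is a pi-system, from which independence extends to the generated
  sigma-algebra.\<close>

definition past_gen :: "real \<Rightarrow> 'w set set" where
  "past_gen t = {{w \<in> space M. \<forall>(n, s)\<in>S. T n w \<le> s} | S. finite S \<and> (\<forall>(n, s)\<in>S. s \<le> t)}"

definition past :: "real \<Rightarrow> 'w measure" where
  "past t = sigma (space M) (past_gen t)"

lemma past_gen_subset: "past_gen t \<subseteq> Pow (space M)"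
  unfolding past_gen_def by auto

lemma space_past: "space (past t) = space M"
  unfolding past_def by (rule space_measure_of[OF past_gen_subset])

lemma sets_past: "sets (past t) = sigma_sets (space M) (past_gen t)"
  unfolding past_def by (rule sets_measure_of[OF past_gen_subset])

lemma past_gen_events: "past_gen t \<subseteq> events"
proof -
  have "{w \<in> space M. \<forall>(n, s)\<in>S. T n w \<le> s} \<in> events" if "finite S" for S :: "(nat \<times> real) set"
  proof -
    have "{w \<in> space M. \<forall>x\<in>S. T (fst x) w \<le> snd x} \<in> events"
      using that by (intro sets.sets_Collect_finite_All) measurable
    then show ?thesis by (simp add: case_prod_beta)
  qed
  then show ?thesis unfolding past_gen_def by auto
qed

lemma subalgebra_past: "subalgebra M (past t)"
  unfolding subalgebra_def space_past sets_past
  using sets.sigma_sets_subset[OF past_gen_events] by simp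

lemma sets_past_le: "s \<le> t \<Longrightarrow> {w \<in> space M. T n w \<le> s} \<in> sets (past t)"
  unfolding sets_past past_gen_def
  by (intro sigma_sets.Basic CollectI exI[of _ "{(n, s)}"]) auto

text \<open>The past at \<open>t\<close> tells whether event \<open>n\<close> has happened and, if
  so, when; truncation at \<open>t\<close> keeps exactly this information about
  \<open>T n\<close>.\<close>

lemma min_times_past: "(\<lambda>w. min (T n w) t) \<in> borel_measurable (past t)"
proof (rule borel_measurableI_le)
  fix y
  have "{w \<in> space (past t). min (T n w) t \<le> y} = (if y < t then {w \<in> space M. T n w \<le> y} else space M)"
    by (auto simp: space_past)
  then show "{w \<in> space (past t). min (T n w) t \<le> y} \<in> sets (past t)"
    using sets_past_le[of y t n] sets.top[of "past t"] by (auto simp: space_past)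
qed

lemma Int_stable_past_gen: "Int_stable (past_gen t)"
proof (rule Int_stableI)
  fix E E' assume "E \<in> past_gen t" "E' \<in> past_gen t"
  then obtain S S' where "finite S" "\<forall>(n, s)\<in>S. s \<le> t" "E = {w \<in> space M. \<forall>(n, s)\<in>S. T n w \<le> s}"
    "finite S'" "\<forall>(n, s)\<in>S'. s \<le> t" "E' = {w \<in> space M. \<forall>(n, s)\<in>S'. T n w \<le> s}"
    unfolding past_gen_def by auto
  then show "E \<inter> E' \<in> past_gen t"
    unfolding past_gen_def by (intro CollectI exI[of _ "S \<union> S'"]) auto
qed

text \<open>A generating event is determined by the counts over a finite grid of \<open>[a, t]\<close>; extending the grid
  by the single point \<open>u\<close> makes the count over \<open>(t, u]\<close> one more increment.\<close>

lemma prob_past_gen_Int: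
  assumes at: "a \<le> t" "t \<le> u" and E: "E \<in> past_gen t"
  shows "prob (E \<inter> {w \<in> space M. num_events T t u w = j}) = prob E * prob {w \<in> space M. num_events T t u w = j}"
proof -
  obtain S where S: "finite S" "\<forall>(n, s)\<in>S. s \<le> t" "E = {w \<in> space M. \<forall>(n, s)\<in>S. T n w \<le> s}"
    using E unfolding past_gen_def by auto
  \<comment> \<open>For \<open>s < a\<close> the constraint is moved to \<open>a\<close>: almost
    surely both \<open>T n w \<le> s\<close> and \<open>T n w \<le> a\<close> fail. The points
    \<open>a\<close> and \<open>t\<close> fix the two ends of the grid.\<close>
  define V where "V = insert a (insert t ((\<lambda>(n, s). max a s) ` S))"
  define l where "l = sorted_list_of_set V"
  define L where "L = length l - 1"
  \<comment> \<open>\<open>independent_increments\<close> takes an infinite monotone sequence, so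
    the grid is continued by the constant \<open>u\<close>. Increment number \<open>L\<close> is
    then the count over \<open>(t, u]\<close>.\<close>
  define g where "g i = (if i \<le> L then l ! i else u)" for i
  have V: "finite V" "V \<subseteq> {a..t}" using S at unfolding V_def by auto
  have l: "set l = V" "sorted l" unfolding l_def using V by auto
  have "l \<noteq> []" using l(1) unfolding V_def by auto
  then have len: "length l = Suc L" unfolding L_def by (cases l) auto
  have lV: "l ! i \<in> V" if "i \<le> L" for i using that len l(1) by (metis le_imp_less_Suc nth_mem)
  have idx: "\<exists>i\<le>L. l ! i = v" if "v \<in> V" for v
    using that len unfolding l(1)[symmetric] in_set_conv_nth by (auto simp: less_Suc_eq_le)
  have mono_l: "l ! i \<le> l ! i'" if "i \<le> i'" "i' \<le> L" for i i'
    using sorted_nth_mono[OF l(2) that(1)] that(2) len by simp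
  have g0: "g 0 = a"
  proof -
    obtain i where i: "i \<le> L" "l ! i = a" using idx[of a] unfolding V_def by auto
    have "l ! 0 \<le> a" using mono_l[of 0 i] i by simp
    moreover have "a \<le> l ! 0" using lV[of 0] V(2) by auto
    ultimately show ?thesis unfolding g_def by simp
  qed
  have gL: "g L = t"
  proof -
    obtain i where i: "i \<le> L" "l ! i = t" using idx[of t] unfolding V_def by auto
    have "t \<le> l ! L" using mono_l[of i L] i by simp
    moreover have "l ! L \<le> t" using lV[of L] V(2) by auto
    ultimately show ?thesis unfolding g_def by simp
  qed
  have g_mono: "mono g"
  proof (rule monoI)
    fix i i' :: nat assume "i \<le> i'"
    moreover have "l ! i \<le> u" if "i \<le> L" for i using lV[OF that] V(2) at by auto
    ultimately show "g i \<le> g i'" unfolding g_def using mono_l by auto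
  qed
  have gSL: "g (Suc L) = u" unfolding g_def by simp
  define D where "D i = num_events T (g i) (g (Suc i))" for i
  have ind: "indep_vars (\<lambda>_. count_space UNIV) D UNIV"
    unfolding D_def using independent_increments[of g] g0 g_mono by simp
  obtain I where I: "\<And>v. v \<in> V \<Longrightarrow> I v \<le> L \<and> g (I v) = v"
  proof -
    have "\<forall>v\<in>V. \<exists>i. i \<le> L \<and> g i = v" using idx unfolding g_def by auto
    then show ?thesis using that by metis
  qed
  \<comment> \<open>\<open>Y1\<close> reads only the increments below \<open>L\<close> and
    \<open>Y2\<close> only increment \<open>L\<close>: functions of disjoint blocks of an
    independent family.\<close>
  define Y1 where "Y1 \<omega> = (\<forall>(n, s)\<in>S. n < (\<Sum>i<I (max a s). \<omega> i))" for \<omega> :: "nat \<Rightarrow> nat"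
  define Y2 where "Y2 \<omega> = (\<omega> L = j)" for \<omega> :: "nat \<Rightarrow> nat"
  have mS: "max a s \<in> V" if "(n, s) \<in> S" for n s using that unfolding V_def by force
  have m1: "Y1 \<in> measurable (PiM {..<L} (\<lambda>_. count_space UNIV)) (count_space UNIV)"
  proof -
    have "(\<lambda>\<omega>. \<forall>x\<in>S. fst x < (\<Sum>i<I (max a (snd x)). \<omega> i))
        \<in> measurable (PiM {..<L} (\<lambda>_. count_space UNIV)) (count_space (UNIV :: bool set))"
    proof (intro pred_intros_finite(3)[OF S(1)])
      fix x assume "x \<in> S"
      then have "I (max a (snd x)) \<le> L" using mS[of "fst x" "snd x"] I by simp
      then have [measurable]: "i \<in> {..<I (max a (snd x))} \<Longrightarrow>
          (\<lambda>\<omega>. \<omega> i) \<in> measurable (PiM {..<L} (\<lambda>_. count_space UNIV)) (count_space (UNIV :: nat set))" for i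
        by (intro measurable_component_singleton) auto
      have [measurable]: "(\<lambda>\<omega>. \<Sum>i<I (max a (snd x)). \<omega> i)
         \<in> measurable (PiM {..<L} (\<lambda>_. count_space UNIV)) (count_space (UNIV :: nat set))"
        by measurable
      show "(\<lambda>\<omega>. fst x < (\<Sum>i<I (max a (snd x)). \<omega> i))
        \<in> measurable (PiM {..<L} (\<lambda>_. count_space UNIV)) (count_space (UNIV :: bool set))"
        by measurable
    qed
    then show ?thesis unfolding Y1_def [abs_def] by (simp add: case_prod_beta')
  qed
  have m2: "Y2 \<in> measurable (PiM {L} (\<lambda>_. count_space UNIV)) (count_space UNIV)"
  proof -
    have [measurable]: "(\<lambda>\<omega>. \<omega> L) \<in> measurable (PiM {L} (\<lambda>_. count_space UNIV)) (count_space (UNIV :: nat set))"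
      by (intro measurable_component_singleton) auto
    show ?thesis unfolding Y2_def [abs_def] by measurable
  qed
  let ?X1 = "\<lambda>\<omega>. restrict (\<lambda>i. D i \<omega>) {..<L}" and ?X2 = "\<lambda>\<omega>. restrict (\<lambda>i. D i \<omega>) {L}"
  have "indep_var (count_space UNIV) (Y1 \<circ> ?X1) (count_space UNIV) (Y2 \<circ> ?X2)"
    by (rule indep_var_compose[OF indep_var_restrict[OF ind] m1 m2]) auto
  from indep_varD[OF this, of "{True}" "{True}"]
  have prod: "prob ({w \<in> space M. Y1 (?X1 w)} \<inter> {w \<in> space M. Y2 (?X2 w)})
      = prob {w \<in> space M. Y1 (?X1 w)} * prob {w \<in> space M. Y2 (?X2 w)}"
    by (auto simp: vimage_def Int_def conj_ac cong: conj_cong)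
  have m1': "{w \<in> space M. Y1 (?X1 w)} \<in> events"
  proof -
    have "?X1 \<in> measurable M (PiM {..<L} (\<lambda>_. count_space UNIV))"
      using ind by (intro measurable_restrict) (auto simp: indep_vars_def)
    from measurable_compose[OF this m1] show ?thesis by measurable
  qed
  have Y2D: "{w \<in> space M. Y2 (?X2 w)} = {w \<in> space M. num_events T t u w = j}"
    unfolding Y2_def D_def by (simp add: gL gSL)
  have E_AE: "AE w in M. w \<in> E \<longleftrightarrow> w \<in> {w \<in> space M. Y1 (?X1 w)}"
    using AE_regular AE_space
  proof eventually_elim
    case (elim w)
    then have reg: "a < T 0 w" "strict_mono (\<lambda>n. T n w)" "filterlim (\<lambda>n. T n w) at_top sequentially" by auto
    have cnt: "(\<Sum>i<m. D i w) = num_events T a (g m) w" for m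
    proof (induction m)
      case 0
      have e: "{n. a < T n w \<and> T n w \<le> a} = {}" by auto
      show ?case unfolding g0 num_events_def e by simp
    next
      case (Suc m)
      have "a \<le> g m" using monoD[OF g_mono, of 0 m] g0 by simp
      then show ?case
        using Suc num_events_add[where T = T and w = w, OF reg, of "g m" "g (Suc m)"] monoD[OF g_mono, of m "Suc m"] by (simp add: D_def)
    qed
    have "n < (\<Sum>i<I (max a s). restrict (\<lambda>i. D i w) {..<L} i) \<longleftrightarrow> T n w \<le> s" if "(n, s) \<in> S" for n s
    proof -
      have I': "I (max a s) \<le> L" "g (I (max a s)) = max a s" using I mS that by auto
      have "(\<Sum>i<I (max a s). restrict (\<lambda>i. D i w) {..<L} i) = (\<Sum>i<I (max a s). D i w)"
        by (rule sum.cong) (use I' in auto)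
      then have "n < (\<Sum>i<I (max a s). restrict (\<lambda>i. D i w) {..<L} i) \<longleftrightarrow> T n w \<le> max a s"
        using less_num_events_iff[where T = T and w = w, OF reg] by (simp add: cnt I')
      also have "\<dots> \<longleftrightarrow> T n w \<le> s" using start_less[where T = T and w = w, OF reg, of n] by (auto simp: le_max_iff_disj)
      finally show ?thesis .
    qed
    then show ?case using elim unfolding S(3) Y1_def by auto
  qed
  have [measurable]: "E \<in> events" using E past_gen_events by auto
  note m1' [measurable]
  have "prob E = prob {w \<in> space M. Y1 (?X1 w)}"
    by (rule finite_measure_eq_AE) (use E_AE m1' in auto)
  moreover have "prob (E \<inter> {w \<in> space M. num_events T t u w = j})
      = prob ({w \<in> space M. Y1 (?X1 w)} \<inter> {w \<in> space M. num_events T t u w = j})"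
    by (rule finite_measure_eq_AE) (use E_AE m1' in \<open>auto elim!: eventually_mono\<close>)
  ultimately show ?thesis using prod unfolding Y2D by simp
qed

text \<open>Independence on the pi-system \<open>past_gen t\<close> extends to the sigma-algebra it
  generates, and expectations of products of independent bounded variables factor.\<close>

lemma expectation_past_indep:
  assumes at: "a \<le> t" "t \<le> u" and Z: "Z \<in> borel_measurable (past t)"
    and C: "\<And>w. w \<in> space M \<Longrightarrow> \<bar>Z w\<bar> \<le> C"
  shows "expectation (\<lambda>w. Z w * indicator {w \<in> space M. num_events T t u w = j} w)
    = expectation Z * prob {w \<in> space M. num_events T t u w = j}"
proof -
  let ?D = "{w \<in> space M. num_events T t u w = j}"
  have D: "?D \<in> events" by measurable
  have "indep_set (past_gen t) {?D}"
    unfolding indep_sets2_eq using prob_past_gen_Int[OF at] past_gen_events D by auto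
  then have ind: "indep_set (sets (past t)) (sigma_sets (space M) {?D})"
    unfolding sets_past by (intro indep_set_sigma_sets Int_stable_past_gen) (auto simp: Int_stable_def)
  have ZM: "Z \<in> borel_measurable M"
    using measurable_from_subalg[OF subalgebra_past Z] .
  have iD: "(indicator ?D :: 'w \<Rightarrow> real) \<in> borel_measurable (sigma (space M) {?D})"
    by (intro borel_measurable_indicator) (auto intro: sigma_sets.Basic)
  have "indep_var borel Z borel (indicator ?D :: 'w \<Rightarrow> real)"
    unfolding indep_var_eq indep_sets2_eq
  proof (intro conjI ballI)
    let ?SZ = "sigma_sets (space M) {Z -` A \<inter> space M |A. A \<in> sets borel}"
    let ?SD = "sigma_sets (space M) {(indicator ?D :: 'w \<Rightarrow> real) -` A \<inter> space M |A. A \<in> sets borel}"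
    have sZ: "?SZ \<subseteq> sets (past t)"
      by (rule sigma_sets_vimage_subset[OF Z]) (simp add: space_past)
    have sD: "?SD \<subseteq> sigma_sets (space M) {?D}"
      using sigma_sets_vimage_subset[OF iD, of M] by auto
    show "?SZ \<subseteq> events" "?SD \<subseteq> events"
      using sZ sD ind unfolding indep_sets2_eq by auto
    fix x y assume "x \<in> ?SZ" "y \<in> ?SD"
    then show "prob (x \<inter> y) = prob x * prob y"
      using sZ sD ind unfolding indep_sets2_eq by blast
  qed (use ZM D in auto)
  then have "expectation (\<lambda>w. Z w * indicator ?D w) = expectation Z * expectation (indicator ?D)"
    by (rule indep_var_lebesgue_integral)
      (use integrable_bounded[OF ZM C] integrable_bounded[of "indicator ?D" 1] D in auto)
  then show ?thesis using D by simp
qed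

end

section \<open>Runs of the swap process\<close>

lemma abs_le_multI:
  fixes x y :: real
  assumes "\<bar>x\<bar> \<le> a" "\<bar>y\<bar> \<le> b"
  shows "\<bar>x * y\<bar> \<le> a * b"
  unfolding abs_mult using assms by (intro mult_mono) (auto intro: order_trans[OF abs_ge_zero])

text \<open>Evaluating \<open>g\<close> at the next point of a grid of mesh \<open>1 / Suc m\<close>
  to the right of \<open>t\<close> gives functions that depend on \<open>t\<close> through an
  integer, hence are measurable, and right continuity makes them converge to \<open>g t\<close>. The
  cap at \<open>b\<close> keeps the grid point inside \<open>{t..b}\<close>.\<close>

lemma borel_measurable_right_continuous:
  fixes g :: "real \<Rightarrow> real"
  assumes "\<And>t. t \<in> {a..b} \<Longrightarrow> continuous (at t within {t..b}) g"
  shows "(\<lambda>t. if t \<in> {a..b} then g t else 0) \<in> borel_measurable borel"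
proof (rule borel_measurable_LIMSEQ_real)
  define s where "s m t = min b ((of_int \<lfloor>real (Suc m) * t\<rfloor> + 1) / real (Suc m))" for m t
  show "(\<lambda>t. if t \<in> {a..b} then g (s m t) else 0) \<in> borel_measurable borel" for m
  proof -
    have "(\<lambda>z. g (min b ((of_int z + 1) / real (Suc m)))) \<in> measurable (count_space (UNIV :: int set)) borel"
      by simp
    moreover have "(\<lambda>t. \<lfloor>real (Suc m) * t\<rfloor>) \<in> measurable borel (count_space UNIV)"
      by measurable
    ultimately have [measurable]: "(\<lambda>t. g (s m t)) \<in> borel_measurable borel"
      unfolding s_def by (rule measurable_compose[rotated])
    show ?thesis by measurable
  qed
  fix t
  show "(\<lambda>m. if t \<in> {a..b} then g (s m t) else 0) \<longlonglongrightarrow> (if t \<in> {a..b} then g t else 0)"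
  proof (cases "t \<in> {a..b}")
    case True
    have bnd: "t \<le> s m t \<and> s m t \<le> t + inverse (real (Suc m)) \<and> s m t \<le> b" for m
    proof -
      have "t \<le> (of_int \<lfloor>real (Suc m) * t\<rfloor> + 1) / real (Suc m)"
        using floor_correct[of "real (Suc m) * t"] by (simp add: field_simps del: of_nat_Suc)
      moreover have "(of_int \<lfloor>real (Suc m) * t\<rfloor> + 1) / real (Suc m) \<le> t + inverse (real (Suc m))"
        using floor_correct[of "real (Suc m) * t"] by (simp add: field_simps del: of_nat_Suc)
      ultimately show ?thesis unfolding s_def using True by auto
    qed
    have "(\<lambda>m. s m t) \<longlonglongrightarrow> t"
    proof (rule tendsto_sandwich[where f = "\<lambda>_. t"])
      show "(\<lambda>m. t + inverse (real (Suc m))) \<longlonglongrightarrow> t"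
        using tendsto_add[OF tendsto_const LIMSEQ_inverse_real_of_nat, of t] by simp
    qed (use bnd in auto)
    then have "(g \<circ> (\<lambda>m. s m t)) \<longlonglongrightarrow> g t"
      using assms[OF True] bnd unfolding continuous_within_sequentially by auto
    then show ?thesis using True by (simp add: comp_def)
  next
    case False
    show ?thesis unfolding if_not_P[OF False] by simp
  qed
qed

text \<open>Splits by the value of a counting variable, with dominated convergence for the infinite
  sum. The form as a nonnegativity statement serves inequalities directly and equalities by applying
  it to \<open>h\<close> and to its negative.\<close>

lemma (in prob_space) expectation_nonneg_by_cases:
  fixes h :: "'a \<Rightarrow> real" and N :: "'a \<Rightarrow> nat"
  assumes [measurable]: "h \<in> borel_measurable M" "random_variable (count_space UNIV) N"
    and C: "\<And>w. w \<in> space M \<Longrightarrow> \<bar>h w\<bar> \<le> C"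
    and nonneg: "\<And>n. 0 \<le> expectation (\<lambda>w. indicator {n} (N w) * h w)"
  shows "0 \<le> expectation h"
proof -
  have int: "integrable M (\<lambda>w. indicator {n} (N w) * h w)" for n
    by (rule integrable_bounded[where C = C]) (use C in \<open>auto simp: indicator_def intro: order_trans[OF abs_ge_zero]\<close>)
  have "(\<lambda>m. expectation (\<lambda>w. \<Sum>n<m. indicator {n} (N w) * h w)) \<longlonglongrightarrow> expectation h"
  proof (rule integral_dominated_convergence[where w = "\<lambda>_. C"])
    have *: "(\<Sum>n<m. indicator {n} (N w) * h w) = (if N w < m then h w else 0)" for m w
    proof -
      have "(\<Sum>n<m. indicator {n} (N w) * h w) = (\<Sum>n<m. if n = N w then h w else 0)"
        by (rule sum.cong) auto
      then show ?thesis by (simp add: sum.delta)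
    qed
    show "AE w in M. (\<lambda>m. \<Sum>n<m. indicator {n} (N w) * h w) \<longlonglongrightarrow> h w"
    proof (rule AE_I2)
      fix w
      have "\<forall>\<^sub>F m in sequentially. (if N w < m then h w else 0) = h w"
        using eventually_gt_at_top[of "N w"] by eventually_elim simp
      then show "(\<lambda>m. \<Sum>n<m. indicator {n} (N w) * h w) \<longlonglongrightarrow> h w"
        unfolding * by (rule tendsto_eventually)
    qed
    show "AE w in M. norm (\<Sum>n<m. indicator {n} (N w) * h w) \<le> C" for m
      unfolding * by (rule AE_I2) (use C in \<open>auto intro: order_trans[OF abs_ge_zero]\<close>)
  qed auto
  moreover have "0 \<le> expectation (\<lambda>w. \<Sum>n<m. indicator {n} (N w) * h w)" for m
    unfolding Bochner_Integration.integral_sum[OF int] by (intro sum_nonneg nonneg)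
  ultimately show ?thesis by (intro LIMSEQ_le_const) auto
qed

locale greedy_swap_run = greedy_swap_poisson_process M U indep \<epsilon> swap A\<^sub>0 T X + matroid U indep
  for M :: "'w measure" and U :: "'a set" and indep :: "'a set set" and \<epsilon> :: real
    and swap :: "real \<Rightarrow> 'a set \<Rightarrow> ('a \<times> 'a) pmf" and A\<^sub>0 :: "'a set"
    and T :: "nat \<Rightarrow> 'w \<Rightarrow> real" and X :: "nat \<Rightarrow> 'w \<Rightarrow> 'a \<times> 'a" +
  assumes eps: "0 < \<epsilon>" "\<epsilon> \<le> 1"
    and swap_procedure: "swap_procedure U indep \<epsilon> swap"
    and right_continuous: "right_continuous_swap U indep \<epsilon> swap"
begin

abbreviation "B \<equiv> current_base A\<^sub>0 X"

lemma bases_subset: "A \<in> bases indep \<Longrightarrow> A \<subseteq> U"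
  unfolding bases_def using indep_subset by auto

lemma finite_pairs: "finite (U \<times> U)"
  using finite_ground by simp

lemma exchange_subset: "A \<subseteq> U \<Longrightarrow> p \<in> U \<times> U \<Longrightarrow> exchange A p \<subseteq> U"
  unfolding exchange_def by auto

lemma set_pmf_swap:
  assumes "A \<in> bases indep" "t \<in> {\<epsilon>..1}" "p \<in> set_pmf (swap t A)"
  shows "p \<in> U \<times> U" "fst p \<in> A" "snd p \<in> U" "exchange A p \<in> bases indep"
  using swap_procedure assms bases_subset[of A] unfolding swap_procedure_def by (cases p; fastforce)+

lemma X_space: "w \<in> space M \<Longrightarrow> X n w \<in> U \<times> U"
  using measurable_space[OF swaps_rv] by simp

section \<open>Measurability with respect to the history of calls\<close>

abbreviation "hist \<equiv> history M T X"

lemma history_gen_events: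
  "{T m -` D \<inter> space M | m D. D \<in> sets borel} \<union> {X m -` {p} \<inter> space M | m p. m < n} \<subseteq> events"
proof -
  have "X m -` {p} \<inter> space M \<in> events" for m p
  proof (cases "p \<in> U \<times> U")
    case True
    then show ?thesis using measurable_sets[OF swaps_rv[of m], of "{p}"] by simp
  next
    case False
    then have "X m -` {p} \<inter> space M = {}" using X_space by blast
    then show ?thesis by simp
  qed
  moreover have "T m -` D \<inter> space M \<in> events" if "D \<in> sets borel" for m D
    using measurable_sets[OF times_rv that] .
  ultimately show ?thesis by blast
qed

lemma space_history: "space (hist n) = space M"
  and sets_history: "sets (hist n) = sigma_sets (space M)
     ({T m -` D \<inter> space M | m D. D \<in> sets borel} \<union> {X m -` {p} \<inter> space M | m p. m < n})"
proof -
  have *: "{T m -` D \<inter> space M | m D. D \<in> sets borel} \<union> {X m -` {p} \<inter> space M | m p. m < n} \<subseteq> Pow (space M)"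
    by auto
  show "space (hist n) = space M" "sets (hist n) = sigma_sets (space M)
     ({T m -` D \<inter> space M | m D. D \<in> sets borel} \<union> {X m -` {p} \<inter> space M | m p. m < n})"
    unfolding history_def by (rule space_measure_of[OF *], rule sets_measure_of[OF *])
qed

lemma subalgebra_history: "subalgebra M (hist n)"
  unfolding subalgebra_def space_history sets_history
  using sets.sigma_sets_subset[OF history_gen_events] by simp

lemma from_history: "g \<in> measurable (hist n) N \<Longrightarrow> g \<in> measurable M N"
  by (rule measurable_from_subalg[OF subalgebra_history])

text \<open>Any \<open>m\<close> is allowed, also \<open>m \<ge> n\<close>: the history contains the
  whole Poisson process, and only the calls are revealed one by one.\<close>

lemma T_history [measurable]: "T m \<in> borel_measurable (hist n)"
  by (rule measurableI) (auto simp: space_history sets_history intro!: sigma_sets.Basic)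

lemma X_history: "m < n \<Longrightarrow> X m \<in> measurable (hist n) (count_space (U \<times> U))"
  unfolding measurable_count_space_eq2[OF finite_pairs]
  by (auto simp: space_history sets_history X_space intro!: sigma_sets.Basic) (use X_space in force)+

lemma exchange_measurable:
  assumes "g \<in> measurable N (count_space (Pow U))" "h \<in> measurable N (count_space (U \<times> U))"
  shows "(\<lambda>w. exchange (g w) (h w)) \<in> measurable N (count_space (Pow U))"
proof (rule measurable_compose_countable'[OF _ assms(1)])
  fix A assume "A \<in> Pow U"
  then have "exchange A \<in> measurable (count_space (U \<times> U)) (count_space (Pow U))"
    using exchange_subset by auto
  then show "(\<lambda>w. exchange A (h w)) \<in> measurable N (count_space (Pow U))"
    by (rule measurable_compose[OF assms(2)])
qed (use finite_ground in \<open>auto intro: countable_finite\<close>)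

lemma B_history [measurable]: "m \<le> n \<Longrightarrow> B m \<in> measurable (hist n) (count_space (Pow U))"
proof (induction m)
  case 0
  show ?case using bases_subset[OF initial_base] by simp
next
  case (Suc m)
  then show ?case using X_history[of m n] by (auto intro: exchange_measurable)
qed

lemma B_measurable [measurable]: "B m \<in> measurable M (count_space (Pow U))"
  using from_history[OF B_history[of m m]] by simp

lemma B_space: "w \<in> space M \<Longrightarrow> B m w \<subseteq> U"
  using measurable_space[OF B_measurable] by simp

lemma fun_B_measurable:
  fixes G :: "'a set \<Rightarrow> 'b \<Rightarrow> real"
  assumes "\<And>A. A \<in> Pow U \<Longrightarrow> G A \<in> borel_measurable N" "Y \<in> measurable N (count_space (Pow U))"
  shows "(\<lambda>w. G (Y w) w) \<in> borel_measurable N"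
  by (rule measurable_compose_countable'[OF assms])
    (use finite_ground in \<open>auto intro: countable_finite\<close>)

section \<open>Integrating out a fresh call\<close>

lemma expectation_fresh_raw:
  assumes W: "W \<in> borel_measurable (hist n)" and C: "\<And>w. w \<in> space M \<Longrightarrow> \<bar>W w\<bar> \<le> C"
    and p: "p \<in> U \<times> U"
  shows "expectation (\<lambda>w. W w * indicator {p} (X n w))
    = expectation (\<lambda>w. W w * real_cond_exp M (hist n) (\<lambda>w. indicator {p} (X n w)) w)"
proof -
  interpret finite_measure_subalgebra M "hist n"
    by standard (rule subalgebra_history)
  have X: "(\<lambda>w. indicator {p} (X n w) :: real) \<in> borel_measurable M"
    by (rule measurable_compose[OF swaps_rv]) simp
  have "integrable M (\<lambda>w. W w * indicator {p} (X n w))"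
    using C by (intro integrable_bounded[where C = C] borel_measurable_times from_history[OF W] X)
      (auto simp: indicator_def intro: order_trans[OF abs_ge_zero])
  then show ?thesis using real_cond_exp_intg(2)[OF _ W X] by simp
qed

lemma AE_eps_less: "AE w in M. \<forall>m. \<epsilon> < T m w"
  by (rule AE_start_less)

text \<open>The support condition on \<open>swap\<close> concerns conditional laws and has to be
  transferred to paths. For each of the finitely many pairs of a base and a result that would leave
  the bases, the indicator of its occurrence before time 1 is nonnegative with expectation 0, hence
  vanishes almost everywhere.\<close>

lemma AE_step_in_bases:
  "AE w in M. T n w < 1 \<and> B n w \<in> bases indep \<longrightarrow> B (Suc n) w \<in> bases indep"
proof -
  let ?bad = "{(A, p) \<in> Pow U \<times> (U \<times> U). A \<in> bases indep \<and> exchange A p \<notin> bases indep}"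
  have fin: "finite ?bad"
    by (rule finite_subset[of _ "Pow U \<times> (U \<times> U)"]) (use finite_ground in auto)
  have "AE w in M. \<not> (B n w = A \<and> X n w = p \<and> T n w < 1)" if "(A, p) \<in> ?bad" for A p
  proof -
    define W :: "'w \<Rightarrow> real" where "W w = indicator {A} (B n w) * indicator {..<1} (T n w)" for w
    have A: "A \<in> bases indep" "exchange A p \<notin> bases indep" "A \<in> Pow U" "p \<in> U \<times> U" using that by auto
    have iB: "(\<lambda>w. indicator {A} (B n w) :: real) \<in> borel_measurable (hist n)"
      by (rule measurable_compose[OF B_history[OF order_refl]]) simp
    have W: "W \<in> borel_measurable (hist n)"
      unfolding W_def [abs_def] by (intro borel_measurable_times iB) measurable
    have X: "(\<lambda>w. indicator {p} (X n w) :: real) \<in> borel_measurable M"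
      by (rule measurable_compose[OF swaps_rv]) simp
    have W1: "\<bar>W w\<bar> \<le> 1" for w unfolding W_def by (auto simp: indicator_def)
    have "expectation (\<lambda>w. W w * indicator {p} (X n w))
      = expectation (\<lambda>w. W w * real_cond_exp M (hist n) (\<lambda>w. indicator {p} (X n w)) w)"
      by (rule expectation_fresh_raw[OF W W1 A(4)])
    also have "\<dots> = expectation (\<lambda>w. 0)"
    proof (rule integral_cong_AE)
      show "(\<lambda>w. W w * real_cond_exp M (hist n) (\<lambda>w. indicator {p} (X n w)) w) \<in> borel_measurable M"
        using from_history[OF W] by measurable
      show "AE w in M. W w * real_cond_exp M (hist n) (\<lambda>w. indicator {p} (X n w)) w = 0"
        using fresh_swaps[OF A(4), of n] AE_eps_less
      proof eventually_elim
        case (elim w)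
        show ?case
        proof (cases "W w = 0")
          case False
          then have w: "B n w = A" "T n w < 1" unfolding W_def by (auto simp: indicator_def split: if_splits)
          have "T n w \<in> {\<epsilon>..1}" using w elim(2)[rule_format, of n] by simp
          then have "p \<notin> set_pmf (swap (T n w) A)"
            using set_pmf_swap(4)[OF A(1)] A(2) by blast
          then have "pmf (swap (T n w) A) p = 0" by (simp add: pmf_eq_0_set_pmf)
          then show ?thesis using elim w by simp
        qed simp
      qed
    qed simp
    finally have "expectation (\<lambda>w. W w * indicator {p} (X n w)) = 0" by simp
    moreover have "integrable M (\<lambda>w. W w * indicator {p} (X n w))"
      by (intro integrable_bounded[where C = 1] borel_measurable_times from_history[OF W] X)
        (use W1 in \<open>auto simp: indicator_def\<close>)
    ultimately have "AE w in M. W w * indicator {p} (X n w) = 0"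
      by (subst (asm) integral_nonneg_eq_0_iff_AE) (auto simp: W_def)
    then show ?thesis
      by eventually_elim (auto simp: W_def)
  qed
  then have "AE w in M. \<forall>(A, p)\<in>?bad. \<not> (B n w = A \<and> X n w = p \<and> T n w < 1)"
    using AE_finite_all[OF fin, where P = "\<lambda>w x. \<not> (B n w = fst x \<and> X n w = snd x \<and> T n w < 1)"]
    by (simp add: case_prod_beta)
  then show ?thesis using AE_space
  proof eventually_elim
    case (elim w)
    then show ?case using B_space[OF elim(2), of n] X_space[OF elim(2), of n] by auto
  qed
qed

lemma AE_in_bases: "AE w in M. (\<forall>m<n. T m w < 1) \<longrightarrow> B n w \<in> bases indep"
proof (induction n)
  case 0
  then show ?case using initial_base by simp
next
  case (Suc n)
  then show ?case using AE_step_in_bases[of n] by eventually_elim auto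
qed

text \<open>The value \<open>0\<close> off the bases and off \<open>[\<epsilon>, 1]\<close> makes \<open>rho\<close> measurable in time for every set.\<close>

definition rho :: "real \<Rightarrow> 'a set \<Rightarrow> 'a \<times> 'a \<Rightarrow> real" where
  "rho t A p = (if A \<in> bases indep \<and> t \<in> {\<epsilon>..1} then pmf (swap t A) p else 0)"

lemma rho_range: "0 \<le> rho t A p" "rho t A p \<le> 1"
  unfolding rho_def by (auto simp: pmf_le_1)

lemma rho_measurable: "p \<in> U \<times> U \<Longrightarrow> (\<lambda>t. rho t A p) \<in> borel_measurable borel"
proof (cases "A \<in> bases indep")
  case True
  assume "p \<in> U \<times> U"
  then have "(\<lambda>t. if t \<in> {\<epsilon>..1} then pmf (swap t A) p else 0) \<in> borel_measurable borel"
    using right_continuous True unfolding right_continuous_swap_def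
    by (intro borel_measurable_right_continuous) auto
  then show ?thesis using True by (simp add: rho_def [abs_def])
qed (simp add: rho_def [abs_def])

lemma rho_T_history: "p \<in> U \<times> U \<Longrightarrow> (\<lambda>w. rho (T n w) (B n w) p) \<in> borel_measurable (hist n)"
  by (rule fun_B_measurable[OF measurable_compose[OF T_history rho_measurable] B_history]) auto

text \<open>The weight has to vanish unless events \<open>0\<close> to \<open>n\<close> all precede
  1: \<open>fresh_swaps\<close> then describes call \<open>n\<close>, and \<open>B n\<close> is
  almost surely a base, so that \<open>rho\<close> coincides with the swap probability.\<close>

lemma expectation_fresh_indicator:
  assumes W: "W \<in> borel_measurable (hist n)" and C: "\<And>w. w \<in> space M \<Longrightarrow> \<bar>W w\<bar> \<le> C"
    and W0: "\<And>w. w \<in> space M \<Longrightarrow> W w \<noteq> 0 \<Longrightarrow> \<forall>m\<le>n. T m w < 1" and p: "p \<in> U \<times> U"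
  shows "expectation (\<lambda>w. W w * indicator {p} (X n w)) = expectation (\<lambda>w. W w * rho (T n w) (B n w) p)"
proof -
  have "expectation (\<lambda>w. W w * real_cond_exp M (hist n) (\<lambda>w. indicator {p} (X n w)) w)
    = expectation (\<lambda>w. W w * rho (T n w) (B n w) p)"
  proof (rule integral_cong_AE)
    show "(\<lambda>w. W w * real_cond_exp M (hist n) (\<lambda>w. indicator {p} (X n w)) w) \<in> borel_measurable M"
      using from_history[OF W] by measurable
    show "(\<lambda>w. W w * rho (T n w) (B n w) p) \<in> borel_measurable M"
      using from_history[OF W] from_history[OF rho_T_history[OF p]] by measurable
    show "AE w in M. W w * real_cond_exp M (hist n) (\<lambda>w. indicator {p} (X n w)) w = W w * rho (T n w) (B n w) p"
      using fresh_swaps[OF p, of n] AE_eps_less AE_in_bases[of n] AE_space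
    proof eventually_elim
      case (elim w)
      show ?case
      proof (cases "W w = 0")
        case False
        then have lt: "\<forall>m\<le>n. T m w < 1" using W0 elim by blast
        then have "T n w \<in> {\<epsilon>..1}" "B n w \<in> bases indep"
          using elim(2)[rule_format, of n] elim(3) by (auto intro: less_imp_le)
        then show ?thesis using elim(1) lt by (simp add: rho_def)
      qed simp
    qed
  qed
  then show ?thesis using expectation_fresh_raw[OF W C p] by simp
qed

lemma finite_fun_bounded:
  fixes v :: "'a set \<Rightarrow> real"
  obtains K where "0 \<le> K" "\<And>A. A \<subseteq> U \<Longrightarrow> \<bar>v A\<bar> \<le> K"
proof
  show "0 \<le> (\<Sum>A\<in>Pow U. \<bar>v A\<bar>)" by (simp add: sum_nonneg)
  fix A assume "A \<subseteq> U"
  then show "\<bar>v A\<bar> \<le> (\<Sum>A\<in>Pow U. \<bar>v A\<bar>)"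
    using finite_ground by (intro member_le_sum) auto
qed

text \<open>A call has finitely many outcomes \<open>p\<close>; for each of them the weight
  \<open>W w * G (B n w) p\<close> is again measurable in the history and subject to
  \<open>expectation_fresh_indicator\<close>.\<close>

lemma expectation_fresh:
  assumes W: "W \<in> borel_measurable (hist n)" and C: "\<And>w. w \<in> space M \<Longrightarrow> \<bar>W w\<bar> \<le> C"
    and W0: "\<And>w. w \<in> space M \<Longrightarrow> W w \<noteq> 0 \<Longrightarrow> \<forall>m\<le>n. T m w < 1"
  shows "expectation (\<lambda>w. W w * G (B n w) (X n w))
    = expectation (\<lambda>w. W w * (\<Sum>p\<in>U \<times> U. rho (T n w) (B n w) p * G (B n w) p))"
proof -
  have X [measurable]: "(\<lambda>w. indicator {p} (X n w) :: real) \<in> borel_measurable M" for p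
    by (rule measurable_compose[OF swaps_rv]) simp
  have G: "(\<lambda>w. G (B n w) p) \<in> borel_measurable (hist n)" for p
    by (rule measurable_compose[OF B_history[OF order_refl]]) simp
  have WG: "(\<lambda>w. W w * G (B n w) p) \<in> borel_measurable (hist n)" for p
    by (intro borel_measurable_times W G)
  note [measurable] = from_history[OF WG] from_history[OF rho_T_history]
  have bound: "\<exists>K. \<forall>w\<in>space M. \<bar>W w * G (B n w) p\<bar> \<le> K" for p
  proof -
    obtain K where K: "0 \<le> K" "\<And>A. A \<subseteq> U \<Longrightarrow> \<bar>G A p\<bar> \<le> K"
      using finite_fun_bounded[of "\<lambda>A. G A p"] by blast
    have "\<bar>W w * G (B n w) p\<bar> \<le> C * K" if "w \<in> space M" for w
      unfolding abs_mult using C[OF that] K B_space[OF that]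
      by (intro mult_mono) (auto intro: order_trans[OF abs_ge_zero])
    then show ?thesis by blast
  qed
  then obtain K where K: "\<And>p w. w \<in> space M \<Longrightarrow> \<bar>W w * G (B n w) p\<bar> \<le> K p" by metis
  have int1: "integrable M (\<lambda>w. W w * G (B n w) p * indicator {p} (X n w))" for p
    by (intro integrable_bounded[where C = "K p"] borel_measurable_times[OF from_history[OF WG] X])
      (use K[of _ p] in \<open>auto simp: indicator_def intro: order_trans[OF abs_ge_zero]\<close>)
  have int2: "integrable M (\<lambda>w. W w * G (B n w) p * rho (T n w) (B n w) p)" if "p \<in> U \<times> U" for p
  proof (rule integrable_bounded[where C = "K p"])
    show "(\<lambda>w. W w * G (B n w) p * rho (T n w) (B n w) p) \<in> borel_measurable M"
      using that by measurable
    fix w assume "w \<in> space M"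
    then have "\<bar>W w * G (B n w) p\<bar> * \<bar>rho (T n w) (B n w) p\<bar> \<le> K p * 1"
      using K[of w p] rho_range[of "T n w" "B n w" p]
      by (intro mult_mono) (auto intro: order_trans[OF abs_ge_zero])
    then show "\<bar>W w * G (B n w) p * rho (T n w) (B n w) p\<bar> \<le> K p"
      by (simp add: abs_mult)
  qed
  have "expectation (\<lambda>w. W w * G (B n w) (X n w))
    = expectation (\<lambda>w. \<Sum>p\<in>U \<times> U. W w * G (B n w) p * indicator {p} (X n w))"
  proof (rule Bochner_Integration.integral_cong[OF refl])
    fix w assume "w \<in> space M"
    then have "(\<Sum>p\<in>U \<times> U. W w * G (B n w) p * indicator {p} (X n w))
        = (\<Sum>p\<in>U \<times> U. if p = X n w then W w * G (B n w) (X n w) else 0)"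
      by (intro sum.cong) auto
    also have "\<dots> = W w * G (B n w) (X n w)"
      using X_space[OF \<open>w \<in> space M\<close>, of n] finite_pairs by (simp add: sum.delta)
    finally show "W w * G (B n w) (X n w) = (\<Sum>p\<in>U \<times> U. W w * G (B n w) p * indicator {p} (X n w))" by simp
  qed
  also have "\<dots> = (\<Sum>p\<in>U \<times> U. expectation (\<lambda>w. W w * G (B n w) p * indicator {p} (X n w)))"
    by (rule Bochner_Integration.integral_sum[OF int1])
  also have "\<dots> = (\<Sum>p\<in>U \<times> U. expectation (\<lambda>w. W w * G (B n w) p * rho (T n w) (B n w) p))"
    by (rule sum.cong[OF refl], rule expectation_fresh_indicator[OF WG K]) (use W0 in auto)
  also have "\<dots> = expectation (\<lambda>w. \<Sum>p\<in>U \<times> U. W w * G (B n w) p * rho (T n w) (B n w) p)"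
    by (rule Bochner_Integration.integral_sum[symmetric, OF int2])
  finally show ?thesis by (simp add: sum_distrib_left mult_ac)
qed


lemma num_events_history [measurable]: "num_events T s t \<in> measurable (hist n) (count_space UNIV)"
  by (rule measurable_num_events[OF T_history])

lemma count_event_history: "{w \<in> space M. num_events T t u w = j} \<in> sets (hist n)"
proof -
  have "{w \<in> space (hist n). num_events T t u w = j} \<in> sets (hist n)" by measurable
  then show ?thesis unfolding space_history .
qed

lemma past_history:
  assumes "Z \<in> measurable (past t) N"
  shows "Z \<in> measurable (hist n) N"
proof -
  have "{w \<in> space M. \<forall>(n, s)\<in>S. T n w \<le> s} \<in> sets (hist n)" if "finite S" for S
  proof -
    have "{w \<in> space (hist n). \<forall>x\<in>S. T (fst x) w \<le> snd x} \<in> sets (hist n)"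
      using that by (intro sets.sets_Collect_finite_All) measurable
    then show ?thesis by (simp add: case_prod_beta space_history)
  qed
  then have "past_gen t \<subseteq> sets (hist n)" unfolding past_gen_def by auto
  then have "subalgebra (hist n) (past t)"
    unfolding subalgebra_def space_past sets_past space_history
    using sets.sigma_sets_subset[of "past_gen t" "hist n"] by (simp add: space_history)
  then show ?thesis using assms by (rule measurable_from_subalg)
qed

text \<open>Given all event times, the law of the base after \<open>n\<close> swaps depends on the first \<open>n\<close> times only;
  the weight \<open>Z\<close> restricts to the case where these are at most \<open>t\<close>.\<close>

lemma expectation_base_indep:
  fixes v :: "'a set \<Rightarrow> real"
  assumes t: "\<epsilon> \<le> t" "t < 1" "t \<le> u"
    and "Z \<in> borel_measurable (past t)"
    and "\<And>w. w \<in> space M \<Longrightarrow> \<bar>Z w\<bar> \<le> C"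
    and "\<And>w. w \<in> space M \<Longrightarrow> Z w \<noteq> 0 \<Longrightarrow> \<forall>m<n. T m w \<le> t"
  shows "expectation (\<lambda>w. v (B n w) * Z w * indicator {w \<in> space M. num_events T t u w = j} w)
     = expectation (\<lambda>w. v (B n w) * Z w) * prob {w \<in> space M. num_events T t u w = j}"
  using assms(4-)
proof (induction n arbitrary: v Z C)
  case 0
  then show ?case
    using expectation_past_indep[OF t(1,3) 0(1,2), of j] by (simp add: mult.assoc)
next
  case (Suc n)
  let ?D = "{w \<in> space M. num_events T t u w = j}"
  \<comment> \<open>Expected value of \<open>v\<close> after call \<open>n\<close> made with base
    \<open>A\<close>. Truncating \<open>T n\<close> at \<open>t\<close> makes it measurable in the
    past, and changes nothing where \<open>Z\<close> is nonzero, since there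
    \<open>T n w \<le> t\<close>.\<close>
  define q where "q w A = (\<Sum>p\<in>U \<times> U. rho (min (T n w) t) A p * v (exchange A p))" for w A
  have q_past: "(\<lambda>w. q w A) \<in> borel_measurable (past t)" for A
    unfolding q_def
    by (intro borel_measurable_sum borel_measurable_times borel_measurable_const
        measurable_compose[OF min_times_past rho_measurable])
  have Zq_past: "(\<lambda>w. Z w * q w A) \<in> borel_measurable (past t)" for A
    by (intro borel_measurable_times q_past Suc.prems(1))
  define Q where "Q A = (\<Sum>p\<in>U \<times> U. \<bar>v (exchange A p)\<bar>)" for A
  have q_bound: "\<bar>q w A\<bar> \<le> Q A" for w A
  proof -
    have "\<bar>q w A\<bar> \<le> (\<Sum>p\<in>U \<times> U. \<bar>rho (min (T n w) t) A p * v (exchange A p)\<bar>)"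
      unfolding q_def by (rule sum_abs)
    also have "\<dots> \<le> (\<Sum>p\<in>U \<times> U. 1 * \<bar>v (exchange A p)\<bar>)"
      unfolding abs_mult by (intro sum_mono mult_right_mono) (use rho_range in auto)
    finally show ?thesis by (simp add: Q_def)
  qed
  have Zq_bound: "\<bar>Z w * q w A\<bar> \<le> C * Q A" if "w \<in> space M" for w A
    by (rule abs_le_multI[OF Suc.prems(2)[OF that] q_bound])
  have Z0: "\<forall>m\<le>n. T m w \<le> t" if "w \<in> space M" "Z w \<noteq> 0" for w
    using Suc.prems(3)[OF that] by (simp add: less_Suc_eq_le)
  have iB: "(\<lambda>w. indicator {A} (B n w) :: real) \<in> borel_measurable M" for A
    by (rule measurable_compose[OF B_measurable]) simp
  \<comment> \<open>Integrates out call \<open>n\<close> and sorts by the base before it. The factor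
    \<open>Y\<close> is kept general because both sides of the claim are needed: once with the
    indicator of the count, once with 1.\<close>
  have split: "expectation (\<lambda>w. v (B (Suc n) w) * Z w * Y w)
      = (\<Sum>A\<in>Pow U. expectation (\<lambda>w. indicator {A} (B n w) * (Z w * q w A) * Y w))"
    if Y: "Y \<in> borel_measurable (hist n)" "\<And>w. \<bar>Y w\<bar> \<le> 1" for Y
  proof -
    have "expectation (\<lambda>w. v (B (Suc n) w) * Z w * Y w)
       = expectation (\<lambda>w. (Z w * Y w) * v (exchange (B n w) (X n w)))"
      by (simp add: mult_ac)
    also have "\<dots> = expectation (\<lambda>w. (Z w * Y w)
        * (\<Sum>p\<in>U \<times> U. rho (T n w) (B n w) p * v (exchange (B n w) p)))"
    proof (rule expectation_fresh)
      show "(\<lambda>w. Z w * Y w) \<in> borel_measurable (hist n)"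
        by (intro borel_measurable_times past_history[OF Suc.prems(1)] Y)
      show "\<bar>Z w * Y w\<bar> \<le> C * 1" if "w \<in> space M" for w
        by (rule abs_le_multI[OF Suc.prems(2)[OF that] Y(2)])
      show "\<forall>m\<le>n. T m w < 1" if "w \<in> space M" "Z w * Y w \<noteq> 0" for w
        using Z0[of w] that t(2) by force
    qed
    also have "\<dots> = expectation (\<lambda>w. \<Sum>A\<in>Pow U. indicator {A} (B n w) * (Z w * q w A) * Y w)"
    proof (rule Bochner_Integration.integral_cong[OF refl])
      fix w assume w: "w \<in> space M"
      have "(\<Sum>A\<in>Pow U. indicator {A} (B n w) * (Z w * q w A) * Y w)
        = (\<Sum>A\<in>Pow U. if A = B n w then Z w * q w (B n w) * Y w else 0)"
        by (intro sum.cong) auto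
      also have "\<dots> = Z w * q w (B n w) * Y w"
        using B_space[OF w, of n] finite_ground by (simp add: sum.delta)
      also have "\<dots> = (Z w * Y w) * (\<Sum>p\<in>U \<times> U. rho (T n w) (B n w) p * v (exchange (B n w) p))"
        using Z0[OF w] by (cases "Z w = 0") (auto simp: q_def min_absorb1)
      finally show "(Z w * Y w) * (\<Sum>p\<in>U \<times> U. rho (T n w) (B n w) p * v (exchange (B n w) p))
        = (\<Sum>A\<in>Pow U. indicator {A} (B n w) * (Z w * q w A) * Y w)" by simp
    qed
    also have "\<dots> = (\<Sum>A\<in>Pow U. expectation (\<lambda>w. indicator {A} (B n w) * (Z w * q w A) * Y w))"
    proof (rule Bochner_Integration.integral_sum)
      fix A
      show "integrable M (\<lambda>w. indicator {A} (B n w) * (Z w * q w A) * Y w)"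
      proof (rule integrable_bounded)
        show "(\<lambda>w. indicator {A} (B n w) * (Z w * q w A) * Y w) \<in> borel_measurable M"
          by (intro borel_measurable_times[OF borel_measurable_times[OF iB]]
              from_history[OF past_history[OF Zq_past]] from_history[OF Y(1)])
        show "\<bar>indicator {A} (B n w) * (Z w * q w A) * Y w\<bar> \<le> 1 * (C * Q A) * 1" if "w \<in> space M" for w
          by (intro abs_le_multI Zq_bound[OF that] Y(2)) (auto simp: indicator_def)
      qed
    qed
    finally show ?thesis .
  qed
  have "expectation (\<lambda>w. v (B (Suc n) w) * Z w * indicator ?D w)
      = (\<Sum>A\<in>Pow U. expectation (\<lambda>w. indicator {A} (B n w) * (Z w * q w A) * indicator ?D w))"
    by (rule split, rule borel_measurable_indicator, rule count_event_history) (simp add: indicator_def)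
  also have "\<dots> = (\<Sum>A\<in>Pow U. expectation (\<lambda>w. indicator {A} (B n w) * (Z w * q w A)) * prob ?D)"
  proof (rule sum.cong[OF refl])
    fix A
    show "expectation (\<lambda>w. indicator {A} (B n w) * (Z w * q w A) * indicator ?D w)
      = expectation (\<lambda>w. indicator {A} (B n w) * (Z w * q w A)) * prob ?D"
      \<comment> \<open>The induction hypothesis is used for the indicator of \<open>{A}\<close> in
        place of \<open>v\<close> and for the weight \<open>Z w * q w A\<close>, which has absorbed
        the law of call \<open>n\<close>.\<close>
      by (rule Suc.IH[OF Zq_past Zq_bound]) (use Z0 in force)+
  qed
  also have "\<dots> = expectation (\<lambda>w. v (B (Suc n) w) * Z w) * prob ?D"
    using split[of "\<lambda>_. 1"] by (simp add: sum_distrib_right)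
  finally show ?case .
qed

section \<open>The base held at a fixed time\<close>

definition base_at :: "real \<Rightarrow> 'w \<Rightarrow> 'a set" where
  "base_at t w = B (num_events T \<epsilon> t w) w"

lemma num_events_measurable [measurable]: "num_events T s t \<in> measurable M (count_space UNIV)"
  by (rule measurable_num_events) simp

lemma base_at_measurable [measurable]: "base_at t \<in> measurable M (count_space (Pow U))"
  unfolding base_at_def [abs_def]
  by (rule measurable_compose_countable[OF B_measurable num_events_measurable])

lemma base_at_subset: "w \<in> space M \<Longrightarrow> base_at t w \<subseteq> U"
  unfolding base_at_def by (rule B_space)

lemma fun_base_at_measurable: "(\<lambda>w. v (base_at t w) :: real) \<in> borel_measurable M"
  by (rule measurable_compose[OF base_at_measurable]) simp

lemma integrable_base_at: "integrable M (\<lambda>w. v (base_at t w) :: real)"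
proof -
  obtain K where "\<And>A. A \<subseteq> U \<Longrightarrow> \<bar>v A\<bar> \<le> K" using finite_fun_bounded[of v] by blast
  then show ?thesis
    by (intro integrable_bounded[where C = K] fun_base_at_measurable) (use base_at_subset in auto)
qed

text \<open>Almost everywhere version of the event that \<open>n\<close> events occur up to
  \<open>t\<close>. Here \<open>T m w \<le> t\<close> for \<open>m < n\<close> holds at every point,
  irregular paths included, as the weights of \<open>expectation_base_indep\<close> require.\<close>

definition count_set :: "real \<Rightarrow> nat \<Rightarrow> 'w set" where
  "count_set t n = {w \<in> space M. (\<forall>m<n. T m w \<le> t) \<and> \<not> T n w \<le> t}"

lemma count_set_past: "count_set t n \<in> sets (past t)"
proof -
  have [measurable]: "Measurable.pred (past t) (\<lambda>w. T m w \<le> t)" for m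
    using sets_past_le[of t t m] by (simp add: pred_def space_past)
  have "{w \<in> space (past t). (\<forall>m<n. T m w \<le> t) \<and> \<not> T n w \<le> t} \<in> sets (past t)" by measurable
  then show ?thesis unfolding count_set_def space_past .
qed

lemma count_set_events: "count_set t n \<in> events"
  using count_set_past subalgebra_past unfolding subalgebra_def by blast

lemma AE_num_events_eq_iff: "AE w in M. \<forall>n t. num_events T \<epsilon> t w = n \<longleftrightarrow> w \<in> count_set t n"
  using AE_regular AE_space
proof eventually_elim
  case (elim w)
  then show ?case
    using num_events_eq_iff[where T = T and w = w and a = \<epsilon>] by (auto simp: count_set_def)
qed

lemma AE_num_events_add: "AE w in M. \<forall>s t. \<epsilon> \<le> s \<longrightarrow> s \<le> t \<longrightarrow>
    num_events T \<epsilon> s w + num_events T s t w = num_events T \<epsilon> t w"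
  using AE_regular
proof eventually_elim
  case (elim w)
  then show ?case
    using num_events_add[where T = T and w = w and a = \<epsilon>] by auto
qed

text \<open>On \<open>count_set t n\<close> the base held at \<open>t\<close> is \<open>B n\<close>,
  so each value \<open>n\<close> of the count falls under \<open>expectation_base_indep\<close> with
  the indicator of \<open>count_set t n\<close> as weight.\<close>

lemma expectation_base_at_indep:
  fixes v :: "'a set \<Rightarrow> real"
  assumes t: "\<epsilon> \<le> t" "t < 1" "t \<le> u"
  shows "expectation (\<lambda>w. v (base_at t w) * indicator {w \<in> space M. num_events T t u w = j} w)
     = expectation (\<lambda>w. v (base_at t w)) * prob {w \<in> space M. num_events T t u w = j}"
proof -
  let ?D = "{w \<in> space M. num_events T t u w = j}"
  define h where "h w = v (base_at t w) * indicator ?D w - v (base_at t w) * prob ?D" for w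
  have D: "?D \<in> events" by measurable
  have hM: "h \<in> borel_measurable M"
    unfolding h_def [abs_def] using D
    by (intro borel_measurable_diff borel_measurable_times fun_base_at_measurable) auto
  obtain K where K: "0 \<le> K" "\<And>A. A \<subseteq> U \<Longrightarrow> \<bar>v A\<bar> \<le> K" using finite_fun_bounded[of v] by blast
  have iD: "\<bar>indicator ?D w\<bar> \<le> (1::real)" for w by (simp add: indicator_def)
  have h_bound: "\<bar>h w\<bar> \<le> K * 1 + K * 1" if "w \<in> space M" for w
  proof -
    have "\<bar>v (base_at t w) * indicator ?D w\<bar> \<le> K * 1"
      by (rule abs_le_multI[OF K(2)[OF base_at_subset[OF that]] iD])
    moreover have "\<bar>v (base_at t w) * prob ?D\<bar> \<le> K * 1"
      by (rule abs_le_multI[OF K(2)[OF base_at_subset[OF that]]]) simp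
    ultimately show ?thesis unfolding h_def by linarith
  qed
  have zero: "expectation (\<lambda>w. indicator {n} (num_events T \<epsilon> t w) * h w) = 0" for n
  proof -
    let ?Z = "indicator (count_set t n) :: 'w \<Rightarrow> real"
    have vB: "(\<lambda>w. v (B n w)) \<in> borel_measurable M"
      by (rule measurable_compose[OF B_measurable]) simp
    have vZ: "integrable M (\<lambda>w. v (B n w) * ?Z w)"
    proof (rule integrable_bounded)
      show "(\<lambda>w. v (B n w) * ?Z w) \<in> borel_measurable M"
        using vB count_set_events by (intro borel_measurable_times) auto
      show "\<bar>v (B n w) * ?Z w\<bar> \<le> K * 1" if "w \<in> space M" for w
        by (rule abs_le_multI[OF K(2)[OF B_space[OF that]]]) (simp add: indicator_def)
    qed
    have vZD: "integrable M (\<lambda>w. v (B n w) * ?Z w * indicator ?D w)"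
      using integrable_real_mult_indicator[OF D vZ] by (simp add: mult_ac)
    have iN: "(\<lambda>w. indicator {n} (num_events T \<epsilon> t w) :: real) \<in> borel_measurable M"
      by (rule measurable_compose[OF num_events_measurable]) simp
    have "expectation (\<lambda>w. indicator {n} (num_events T \<epsilon> t w) * h w)
      = expectation (\<lambda>w. v (B n w) * ?Z w * indicator ?D w - v (B n w) * ?Z w * prob ?D)"
    proof (rule integral_cong_AE)
      show "(\<lambda>w. indicator {n} (num_events T \<epsilon> t w) * h w) \<in> borel_measurable M"
        by (intro borel_measurable_times iN hM)
      show "(\<lambda>w. v (B n w) * ?Z w * indicator ?D w - v (B n w) * ?Z w * prob ?D) \<in> borel_measurable M"
        using vZ vZD by (intro borel_measurable_diff borel_measurable_times[OF borel_measurable_integrable[OF vZ]]) auto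
      show "AE w in M. indicator {n} (num_events T \<epsilon> t w) * h w
          = v (B n w) * ?Z w * indicator ?D w - v (B n w) * ?Z w * prob ?D"
        using AE_num_events_eq_iff
      proof eventually_elim
        case (elim w)
        then have "num_events T \<epsilon> t w = n \<longleftrightarrow> w \<in> count_set t n" by blast
        then show ?case by (auto simp: h_def base_at_def indicator_def)
      qed
    qed
    also have "\<dots> = expectation (\<lambda>w. v (B n w) * ?Z w * indicator ?D w)
        - expectation (\<lambda>w. v (B n w) * ?Z w) * prob ?D"
      using vZ vZD by simp
    also have "expectation (\<lambda>w. v (B n w) * ?Z w * indicator ?D w)
        = expectation (\<lambda>w. v (B n w) * ?Z w) * prob ?D"
    proof (rule expectation_base_indep[OF t])
      show "?Z \<in> borel_measurable (past t)" using count_set_past by (rule borel_measurable_indicator)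
      show "\<bar>?Z w\<bar> \<le> 1" for w by (simp add: indicator_def)
      show "\<forall>m<n. T m w \<le> t" if "?Z w \<noteq> 0" for w
        using that by (cases "w \<in> count_set t n") (simp_all add: count_set_def)
    qed
    also have "\<dots> - \<dots> = 0" by simp
    finally show ?thesis .
  qed
  \<comment> \<open>Each case contributes exactly 0, so the criterion applies to \<open>h\<close>
    and to its negative.\<close>
  have "0 \<le> expectation h"
    by (rule expectation_nonneg_by_cases[OF hM num_events_measurable[of \<epsilon> t] h_bound]) (simp_all only: zero order_refl)
  moreover have "0 \<le> expectation (\<lambda>w. - h w)"
  proof (rule expectation_nonneg_by_cases[OF _ num_events_measurable[of \<epsilon> t]])
    show "\<bar>- h w\<bar> \<le> K * 1 + K * 1" if "w \<in> space M" for w using h_bound[OF that] by simp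
    show "0 \<le> expectation (\<lambda>w. indicator {n} (num_events T \<epsilon> t w) * - h w)" for n
      using zero[of n] by simp
  qed (use hM in simp)
  ultimately have "expectation h = 0" by simp
  moreover have "integrable M (\<lambda>w. v (base_at t w) * indicator ?D w)"
    using integrable_real_mult_indicator[OF D integrable_base_at] by (simp add: mult_ac)
  ultimately show ?thesis
    using integrable_base_at[of v t] unfolding h_def by simp
qed

lemma expectation_no_event:
  fixes v :: "'a set \<Rightarrow> real"
  assumes t: "\<epsilon> \<le> t" "t < 1" "t \<le> u"
  shows "expectation (\<lambda>w. v (base_at u w) * indicator {w \<in> space M. num_events T t u w = 0} w)
     = expectation (\<lambda>w. v (base_at t w)) * prob {w \<in> space M. num_events T t u w = 0}"
  unfolding expectation_base_at_indep[OF t, symmetric]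
proof (rule integral_cong_AE)
  show "AE w in M. v (base_at u w) * indicator {w \<in> space M. num_events T t u w = 0} w =
      v (base_at t w) * indicator {w \<in> space M. num_events T t u w = 0} w"
    using AE_num_events_add
  proof eventually_elim
    case (elim w)
    then have "num_events T \<epsilon> u w = num_events T \<epsilon> t w + num_events T t u w" using t by simp
    then show ?case by (cases "num_events T t u w = 0") (simp_all add: base_at_def)
  qed
qed (intro borel_measurable_times fun_base_at_measurable; measurable)+

section \<open>Poisson counts of the run and consequences of its rate\<close>

lemma rate_integral:
  fixes s t c :: real
  assumes "0 < s" "s \<le> t"
  shows "integral {s..t} (\<lambda>x. c / x) = c * ln (t / s)"
proof -
  have "((\<lambda>x. c / x) has_integral (c * ln t - c * ln s)) {s..t}"
  proof (rule fundamental_theorem_of_calculus[OF assms(2)])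
    fix x assume x: "x \<in> {s..t}"
    then have "((\<lambda>x. c * ln x) has_real_derivative c * (1 / x)) (at x)"
      using assms(1) by (auto intro!: derivative_eq_intros)
    then have "((\<lambda>x. c * ln x) has_real_derivative c / x) (at x within {s..t})"
      by (simp add: has_field_derivative_at_within)
    then show "((\<lambda>x. c * ln x) has_vector_derivative c / x) (at x within {s..t})"
      by (simp add: has_real_derivative_iff_has_vector_derivative)
  qed
  moreover have "c * ln t - c * ln s = c * ln (t / s)"
    using assms by (simp add: ln_div right_diff_distrib)
  ultimately show ?thesis by (simp add: integral_unique)
qed

abbreviation "k \<equiv> real (matroid_rank indep)"

lemma prob_count:
  assumes "\<epsilon> \<le> s" "s \<le> t"
  shows "prob {w \<in> space M. num_events T s t w = n} = (k * ln (t / s)) ^ n / fact n * exp (- (k * ln (t / s)))"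
  using poisson_increments[OF assms, of n] rate_integral[of s t k] assms eps by simp

text \<open>An event at 1 forces an event in \<open>(s, 1]\<close> for every \<open>s < 1\<close>,
  which has probability \<open>1 - exp (k * ln s)\<close>, tending to 0. This reconciles counts,
  which include time 1, with the algorithm, which makes calls strictly before 1.\<close>

lemma AE_no_event_at_1: "AE w in M. \<forall>n. T n w \<noteq> 1"
proof (cases "\<epsilon> < 1")
  case False
  show ?thesis using AE_eps_less
  proof eventually_elim
    case (elim w)
    show ?case
    proof
      fix n
      have "\<epsilon> < T n w" using elim by blast
      then show "T n w \<noteq> 1" using False by linarith
    qed
  qed
next
  case True
  let ?E = "{w \<in> space M. \<exists>n. T n w = 1}"
  have E: "?E \<in> events" by measurable
  have le: "prob ?E \<le> 1 - exp (k * ln s)" if s: "\<epsilon> \<le> s" "s < 1" for s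
  proof -
    have D: "{w \<in> space M. num_events T s 1 w = 0} \<in> events" by measurable
    have "prob ?E \<le> prob (space M - {w \<in> space M. num_events T s 1 w = 0})"
    proof (rule finite_measure_mono_AE)
      show "AE w in M. w \<in> ?E \<longrightarrow> w \<in> space M - {w \<in> space M. num_events T s 1 w = 0}"
        using AE_less_num_events_iff AE_num_events_add
      proof eventually_elim
        case (elim w)
        show ?case
        proof
          assume w: "w \<in> ?E"
          then obtain n where n: "T n w = 1" by auto
          then have "n < num_events T \<epsilon> 1 w" "\<not> n < num_events T \<epsilon> s w" using elim(1) s by auto
          moreover have "num_events T \<epsilon> s w + num_events T s 1 w = num_events T \<epsilon> 1 w"
            using elim(2) s by auto
          ultimately show "w \<in> space M - {w \<in> space M. num_events T s 1 w = 0}" using w by auto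
        qed
      qed
    qed (use D in auto)
    also have "\<dots> = 1 - exp (- (k * ln (1 / s)))"
      using prob_count[of s 1 0] s by (simp add: prob_compl[OF D])
    also have "- (k * ln (1 / s)) = k * ln s" using s eps by (simp add: ln_div)
    finally show ?thesis .
  qed
  have "((\<lambda>s. 1 - exp (k * ln s)) \<longlongrightarrow> 1 - exp (k * ln 1)) (at_left 1)"
    by (intro tendsto_intros) auto
  then have "prob ?E \<le> 1 - exp (k * ln 1)"
  proof (rule tendsto_lowerbound)
    show "\<forall>\<^sub>F s in at_left 1. prob ?E \<le> 1 - exp (k * ln s)"
      using eventually_at_left_real[OF True] by eventually_elim (auto intro: le)
  qed simp
  then have "prob ?E = 0" by (simp add: measure_le_0_iff)
  then show ?thesis using E by (subst (asm) prob_eq_0) auto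
qed

text \<open>With rank 0 the rate is 0, so almost surely no event occurs up to any integer time,
  whereas \<open>T 0\<close> is a real number. The existence of the run thus justifies dividing by
  \<open>k\<close>.\<close>

lemma rank_pos: "matroid_rank indep \<noteq> 0"
proof
  assume 0: "matroid_rank indep = 0"
  have "AE w in M. num_events T \<epsilon> (real m + 1) w = 0" for m :: nat
  proof -
    have "prob {w \<in> space M. num_events T \<epsilon> (real m + 1) w = 0} = 1"
      using prob_count[of \<epsilon> "real m + 1" 0] eps 0 by simp
    moreover have "{w \<in> space M. num_events T \<epsilon> (real m + 1) w = 0} \<in> events" by measurable
    ultimately show ?thesis by (simp add: prob_Collect_eq_1)
  qed
  then have "AE w in M. \<forall>m::nat. num_events T \<epsilon> (real m + 1) w = 0"
    by (simp add: AE_all_countable)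
  then have "AE w in M. False"
    using AE_less_num_events_iff
  proof eventually_elim
    case (elim w)
    obtain m :: nat where "T 0 w \<le> real m" using real_arch_simple by blast
    then have "0 < num_events T \<epsilon> (real m + 1) w" using elim(2) by auto
    then show ?case using elim(1) by simp
  qed
  then show False by simp
qed

lemma AE_base_at_in_bases: "t \<le> 1 \<Longrightarrow> AE w in M. base_at t w \<in> bases indep"
proof -
  assume t: "t \<le> 1"
  have "AE w in M. \<forall>n. (\<forall>m<n. T m w < 1) \<longrightarrow> B n w \<in> bases indep"
    using AE_in_bases by (simp add: AE_all_countable)
  then show ?thesis using AE_less_num_events_iff AE_no_event_at_1
  proof eventually_elim
    case (elim w)
    have "T m w < 1" if "m < num_events T \<epsilon> t w" for m
      using elim(2)[rule_format, of m t] elim(3)[rule_format, of m] that t by linarith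
    then show ?case using elim(1) unfolding base_at_def by blast
  qed
qed

lemma rho_sum:
  assumes "A \<in> bases indep" "t \<in> {\<epsilon>..1}"
  shows "(\<Sum>p\<in>U \<times> U. rho t A p * g p) = measure_pmf.expectation (swap t A) g"
  using assms set_pmf_swap(1)[OF assms] finite_pairs
  by (subst integral_measure_pmf_real[of "U \<times> U"]) (auto simp: rho_def mult.commute)

text \<open>The bound \<open>c\<close> holds for a call at any time of \<open>{t..u}\<close>, hence
  at the random time of the single event. Since \<open>c\<close> depends on the base alone, the
  remaining expectation factors by independence of the base at \<open>t\<close> and the count over
  \<open>(t, u]\<close>.\<close>

lemma expectation_one_event:
  fixes v c :: "'a set \<Rightarrow> real"
  assumes t: "\<epsilon> \<le> t" "t < u" "u \<le> 1"
    and c: "\<And>A s. A \<in> bases indep \<Longrightarrow> s \<in> {t..u} \<Longrightarrow>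
      c A \<le> measure_pmf.expectation (swap s A) (\<lambda>p. v (exchange A p))"
  shows "expectation (\<lambda>w. c (base_at t w)) * prob {w \<in> space M. num_events T t u w = 1}
     \<le> expectation (\<lambda>w. v (base_at u w) * indicator {w \<in> space M. num_events T t u w = 1} w)"
proof -
  let ?D = "{w \<in> space M. num_events T t u w = 1}"
  define h where "h w = indicator ?D w * (v (base_at u w) - c (base_at t w))" for w
  have D: "?D \<in> events" by measurable
  have hM: "h \<in> borel_measurable M"
    unfolding h_def [abs_def] using D
    by (intro borel_measurable_diff borel_measurable_times fun_base_at_measurable) auto
  obtain K where K: "\<And>A. A \<subseteq> U \<Longrightarrow> \<bar>v A\<bar> \<le> K" using finite_fun_bounded[of v] by blast
  obtain K' where K': "\<And>A. A \<subseteq> U \<Longrightarrow> \<bar>c A\<bar> \<le> K'" using finite_fun_bounded[of c] by blast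
  have h_bound: "\<bar>h w\<bar> \<le> 1 * (K + K')" if "w \<in> space M" for w
    unfolding h_def
  proof (rule abs_le_multI)
    show "\<bar>v (base_at u w) - c (base_at t w)\<bar> \<le> K + K'"
      using K[OF base_at_subset[OF that, of u]] K'[OF base_at_subset[OF that, of t]] by linarith
  qed (simp add: indicator_def)
  have "0 \<le> expectation h"
  proof (rule expectation_nonneg_by_cases[OF hM num_events_measurable[of \<epsilon> t] h_bound])
    fix n
    \<comment> \<open>The last factor almost surely equals 1 where the first two do. It is included
      because \<open>expectation_fresh\<close> asks for \<open>T n w < 1\<close> at every point
      where the weight is nonzero.\<close>
    define W :: "'w \<Rightarrow> real" where
      "W w = indicator (count_set t n) w * indicator ?D w * indicator {w \<in> space M. T n w \<le> u \<and> T n w < 1} w" for w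
    have Tu: "{w \<in> space M. T n w \<le> u \<and> T n w < 1} \<in> sets (hist n)"
    proof -
      have "{w \<in> space (hist n). T n w \<le> u \<and> T n w < 1} \<in> sets (hist n)" by measurable
      then show ?thesis unfolding space_history .
    qed
    have iZ: "(indicator (count_set t n) :: 'w \<Rightarrow> real) \<in> borel_measurable (hist n)"
      by (rule past_history[of _ t]) (use count_set_past in auto)
    have W: "W \<in> borel_measurable (hist n)"
      unfolding W_def [abs_def] using Tu count_event_history iZ
      by (intro borel_measurable_times) auto
    have W1: "\<bar>W w\<bar> \<le> 1" for w unfolding W_def by (auto simp: indicator_def)
    have W_pos: "0 \<le> W w" for w unfolding W_def by (auto simp: indicator_def)
    have W0: "w \<in> count_set t n \<and> T n w \<le> u \<and> T n w < 1" if "W w \<noteq> 0" for w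
      using that unfolding W_def by (auto simp: indicator_def split: if_splits)
    let ?G = "\<lambda>A p. v (exchange A p) - c A"
    have GM: "(\<lambda>w. ?G (B n w) (X n w)) \<in> borel_measurable M"
    proof -
      have "(\<lambda>w. v (B (Suc n) w)) \<in> borel_measurable M" "(\<lambda>w. c (B n w)) \<in> borel_measurable M"
        by (rule measurable_compose[OF B_measurable], simp)+
      then show ?thesis by simp
    qed
    have "expectation (\<lambda>w. indicator {n} (num_events T \<epsilon> t w) * h w)
        = expectation (\<lambda>w. W w * ?G (B n w) (X n w))"
    proof (rule integral_cong_AE)
      have iN: "(\<lambda>w. indicator {n} (num_events T \<epsilon> t w) :: real) \<in> borel_measurable M"
        by (rule measurable_compose[OF num_events_measurable]) simp
      show "(\<lambda>w. indicator {n} (num_events T \<epsilon> t w) * h w) \<in> borel_measurable M"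
        by (intro borel_measurable_times iN hM)
      show "(\<lambda>w. W w * ?G (B n w) (X n w)) \<in> borel_measurable M"
        by (intro borel_measurable_times from_history[OF W] GM)
      show "AE w in M. indicator {n} (num_events T \<epsilon> t w) * h w = W w * ?G (B n w) (X n w)"
        using AE_num_events_eq_iff AE_num_events_add AE_less_num_events_iff AE_no_event_at_1 AE_space
      proof eventually_elim
        case (elim w)
        have cs: "num_events T \<epsilon> t w = n \<longleftrightarrow> w \<in> count_set t n" using elim(1) by blast
        show ?case
        proof (cases "num_events T \<epsilon> t w = n \<and> w \<in> ?D")
          case True
          \<comment> \<open>Calls are numbered from 0, so after \<open>n\<close> events the single
            further one is event \<open>n\<close>, and the base at \<open>u\<close> is
            \<open>B (Suc n)\<close>.\<close>
          then have "num_events T \<epsilon> u w = Suc n" using elim(2)[rule_format, of t u] t by simp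
          moreover have "T n w \<le> u" using elim(3)[rule_format, of n u] calculation by simp
          moreover have "T n w < 1" using calculation elim(4)[rule_format, of n] t by linarith
          ultimately show ?thesis
            using True cs elim(5) by (simp add: h_def W_def base_at_def indicator_def)
        next
          case False
          then show ?thesis using cs by (auto simp: h_def W_def indicator_def)
        qed
      qed
    qed
    also have "\<dots> = expectation (\<lambda>w. W w * (\<Sum>p\<in>U \<times> U. rho (T n w) (B n w) p * ?G (B n w) p))"
    proof (rule expectation_fresh[OF W W1])
      fix w assume "W w \<noteq> 0"
      then have "w \<in> count_set t n" "T n w < 1" using W0 by auto
      then have "\<forall>m<n. T m w \<le> t" "T n w < 1" unfolding count_set_def by auto
      then show "\<forall>m\<le>n. T m w < 1" using t by (metis le_less_trans less_le_trans nat_less_le)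
    qed
    also have "\<dots> \<ge> 0"
    proof (rule integral_nonneg_AE)
      show "AE w in M. 0 \<le> W w * (\<Sum>p\<in>U \<times> U. rho (T n w) (B n w) p * ?G (B n w) p)"
        using AE_in_bases[of n]
      proof eventually_elim
        case (elim w)
        show ?case
        proof (cases "W w = 0")
          case False
          then have w: "\<forall>m<n. T m w \<le> t" "\<not> T n w \<le> t" "T n w \<le> u"
            using W0 unfolding count_set_def by auto
          have "T m w < 1" if "m < n" for m using w(1) that t by force
          then have b: "B n w \<in> bases indep" using elim by blast
          have T: "T n w \<in> {\<epsilon>..1}" "T n w \<in> {t..u}" using w t by auto
          have fin: "finite (set_pmf (swap (T n w) (B n w)))"
            by (rule finite_subset[OF _ finite_pairs]) (use set_pmf_swap(1)[OF b T(1)] in blast)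
          have "(\<Sum>p\<in>U \<times> U. rho (T n w) (B n w) p * ?G (B n w) p)
            = measure_pmf.expectation (swap (T n w) (B n w)) (\<lambda>p. v (exchange (B n w) p)) - c (B n w)"
            unfolding rho_sum[OF b T(1)]
            by (subst Bochner_Integration.integral_diff)
              (auto intro: integrable_measure_pmf_finite[OF fin])
          also have "\<dots> \<ge> 0" using c[OF b T(2)] by simp
          finally show ?thesis using W_pos by simp
        qed simp
      qed
    qed
    finally show "0 \<le> expectation (\<lambda>w. indicator {n} (num_events T \<epsilon> t w) * h w)" .
  qed
  also have "expectation h = expectation (\<lambda>w. v (base_at u w) * indicator ?D w)
      - expectation (\<lambda>w. c (base_at t w) * indicator ?D w)"
  proof -
    have "integrable M (\<lambda>w. v (base_at u w) * indicator ?D w)" "integrable M (\<lambda>w. c (base_at t w) * indicator ?D w)"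
      using integrable_real_mult_indicator[OF D integrable_base_at[of v u]]
        integrable_real_mult_indicator[OF D integrable_base_at[of c t]] by (simp_all add: mult_ac)
    then show ?thesis unfolding h_def by (simp add: algebra_simps)
  qed
  also have "expectation (\<lambda>w. c (base_at t w) * indicator ?D w) = expectation (\<lambda>w. c (base_at t w)) * prob ?D"
    by (rule expectation_base_at_indep) (use t in auto)
  finally show ?thesis by simp
qed

section \<open>The number of calls and the returned base\<close>

lemma AE_num_calls: "AE w in M. num_calls T w = num_events T \<epsilon> 1 w"
  using AE_less_num_events_iff AE_no_event_at_1
proof eventually_elim
  case (elim w)
  show ?case unfolding num_calls_def
  proof (rule Least_equality)
    \<comment> \<open>Counting from 0, the number of events up to 1 is the index of the first event
      after 1.\<close>
    show "1 \<le> T (num_events T \<epsilon> 1 w) w"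
      using elim(1)[rule_format, of "num_events T \<epsilon> 1 w" 1] by simp
    show "num_events T \<epsilon> 1 w \<le> m" if "1 \<le> T m w" for m
      using elim(1)[rule_format, of m 1] elim(2)[rule_format, of m] that by linarith
  qed
qed

lemma num_calls_measurable [measurable]: "num_calls T \<in> measurable M (count_space UNIV)"
  unfolding num_calls_def [abs_def] by measurable

lemma returned_base_measurable: "returned_base A\<^sub>0 T X \<in> measurable M (count_space (Pow U))"
  unfolding returned_base_def [abs_def]
  by (rule measurable_compose_countable[OF B_measurable num_calls_measurable])

lemma AE_returned_base: "AE w in M. returned_base A\<^sub>0 T X w = base_at 1 w"
  using AE_num_calls by eventually_elim (simp add: returned_base_def base_at_def)

lemma num_calls_expectation:
  shows "integrable M (\<lambda>w. real (num_calls T w))"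
    and "expectation (\<lambda>w. real (num_calls T w)) = k * ln (1 / \<epsilon>)"
proof -
  have P: "integrable M (\<lambda>w. real (num_events T \<epsilon> 1 w))"
    "expectation (\<lambda>w. real (num_events T \<epsilon> 1 w)) = k * ln (1 / \<epsilon>)"
  proof -
    have "0 \<le> k * ln (1 / \<epsilon>)" using eps by (intro mult_nonneg_nonneg) (auto simp: ln_div)
    from poisson_expectation[OF num_events_measurable this, of \<epsilon> 1] prob_count[of \<epsilon> 1] eps
    show "integrable M (\<lambda>w. real (num_events T \<epsilon> 1 w))"
      "expectation (\<lambda>w. real (num_events T \<epsilon> 1 w)) = k * ln (1 / \<epsilon>)" by auto
  qed
  have AE: "AE w in M. real (num_events T \<epsilon> 1 w) = real (num_calls T w)"
    using AE_num_calls by eventually_elim simp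
  have m: "(\<lambda>w. real (num_calls T w)) \<in> borel_measurable M" "(\<lambda>w. real (num_events T \<epsilon> 1 w)) \<in> borel_measurable M"
    by measurable
  show "integrable M (\<lambda>w. real (num_calls T w))"
    using integrable_cong_AE[OF m(2,1) AE] P by simp
  show "expectation (\<lambda>w. real (num_calls T w)) = k * ln (1 / \<epsilon>)"
    using integral_cong_AE[OF m(2,1) AE] P by simp
qed

end

section \<open>Growth of the expected objective\<close>

lemma poly_bounded_lipschitz:
  fixes p :: "real poly"
  shows "\<exists>C\<ge>0. (\<forall>x\<in>{0..1}. \<bar>poly p x\<bar> \<le> C) \<and> (\<forall>x\<in>{0..1}. \<forall>y\<in>{0..1}. \<bar>poly p x - poly p y\<bar> \<le> C * \<bar>x - y\<bar>)"
proof -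
  obtain C where C: "0 \<le> C" "\<And>x y. x \<in> {0..1} \<Longrightarrow> y \<in> {0..1} \<Longrightarrow> \<bar>poly p x - poly p y\<bar> \<le> C * \<bar>x - y\<bar>"
    using poly_lipschitz[of p] by blast
  have "\<bar>poly p x\<bar> \<le> C + \<bar>poly p 0\<bar>" if "x \<in> {0..1}" for x
  proof -
    have "C * \<bar>x - 0\<bar> \<le> C * 1" using that C(1) by (intro mult_left_mono) auto
    then show ?thesis using C(2)[OF that, of 0] by auto
  qed
  moreover have "\<bar>poly p x - poly p y\<bar> \<le> (C + \<bar>poly p 0\<bar>) * \<bar>x - y\<bar>" if "x \<in> {0..1}" "y \<in> {0..1}" for x y
    using C(2)[OF that] mult_right_mono[of C "C + \<bar>poly p 0\<bar>" "\<bar>x - y\<bar>"] by simp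
  ultimately show ?thesis using C(1) by (intro exI[of _ "C + \<bar>poly p 0\<bar>"]) auto
qed

lemma finite_uniform_bound:
  fixes P :: "'b \<Rightarrow> real \<Rightarrow> bool"
  assumes "finite I" "\<And>i. i \<in> I \<Longrightarrow> \<exists>C\<ge>0. P i C" "\<And>i C C'. P i C \<Longrightarrow> C \<le> C' \<Longrightarrow> P i C'"
  shows "\<exists>C\<ge>0. \<forall>i\<in>I. P i C"
proof -
  obtain c where c: "\<And>i. i \<in> I \<Longrightarrow> 0 \<le> c i \<and> P i (c i)" using assms(2) by metis
  have "P i (sum c I)" if "i \<in> I" for i
    using assms(3)[OF _ member_le_sum[OF that _ assms(1), of c]] c that by auto
  moreover have "0 \<le> sum c I" using c by (simp add: sum_nonneg)
  ultimately show ?thesis by blast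
qed

text \<open>Ground set, set function and base all vary with the index, so that one statement covers
  the extension of \<open>f\<close> and all its partial derivatives.\<close>

lemma multilinear_ext_scaled_indicator_bounds:
  assumes "finite I"
  shows "\<exists>C\<ge>0. \<forall>i\<in>I.
    (\<forall>x\<in>{0..1}. \<bar>multilinear_ext (V i) (g i) (scaled_indicator (A i) x)\<bar> \<le> C) \<and>
    (\<forall>x\<in>{0..1}. \<forall>y\<in>{0..1}. \<bar>multilinear_ext (V i) (g i) (scaled_indicator (A i) x)
      - multilinear_ext (V i) (g i) (scaled_indicator (A i) y)\<bar> \<le> C * \<bar>x - y\<bar>)"
proof (rule finite_uniform_bound[OF assms])
  let ?h = "\<lambda>i x. multilinear_ext (V i) (g i) (scaled_indicator (A i) x)"
  show "\<exists>C\<ge>0. (\<forall>x\<in>{0..1}. \<bar>?h i x\<bar> \<le> C) \<and> (\<forall>x\<in>{0..1}. \<forall>y\<in>{0..1}. \<bar>?h i x - ?h i y\<bar> \<le> C * \<bar>x - y\<bar>)" for i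
    using multilinear_ext_scaled_indicator_poly[of "V i" "g i" "A i"] poly_bounded_lipschitz by metis
  fix i and C C' :: real
  assume *: "(\<forall>x\<in>{0..1}. \<bar>?h i x\<bar> \<le> C) \<and> (\<forall>x\<in>{0..1}. \<forall>y\<in>{0..1}. \<bar>?h i x - ?h i y\<bar> \<le> C * \<bar>x - y\<bar>)"
    and "C \<le> C'"
  then have "C * \<bar>x - y\<bar> \<le> C' * \<bar>x - y\<bar>" for x y :: real by (simp add: mult_right_mono)
  then show "(\<forall>x\<in>{0..1}. \<bar>?h i x\<bar> \<le> C') \<and> (\<forall>x\<in>{0..1}. \<forall>y\<in>{0..1}. \<bar>?h i x - ?h i y\<bar> \<le> C' * \<bar>x - y\<bar>)"
    using * \<open>C \<le> C'\<close> by (meson order_trans)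
qed

text \<open>Here \<open>\<phi>\<close>, \<open>\<sigma>\<close> and \<open>\<omega>\<close> stand
  for the expected value and the expected derivative sums over the current base and over
  \<open>Opt\<close>; \<open>\<Lambda>\<close> is the mean number of events in
  \<open>(t, u]\<close>, so \<open>exp (- \<Lambda>)\<close> and
  \<open>\<Lambda> * exp (- \<Lambda>)\<close> are the probabilities of none and of one. To first
  order \<open>\<Lambda> * t / k\<close> is \<open>\<delta>\<close>, so \<open>\<sigma>\<close>
  cancels and \<open>\<delta> * \<omega>\<close> remains. The five summands of the error constant
  are the errors in facts 1, 2, 5, 3, 4 of the proof, in this order.\<close>

lemma one_step_arith:
  fixes \<epsilon> t u k \<phi> \<sigma> \<omega> L R C :: real
  assumes eps: "0 < \<epsilon>" "\<epsilon> \<le> t" "t < u" and k: "0 < k"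
    and \<phi>: "0 \<le> \<phi>" "\<phi> \<le> L" and \<sigma>: "0 \<le> \<sigma>" "\<sigma> \<le> R" and \<omega>: "0 \<le> \<omega>" "\<omega> \<le> R" and C: "0 \<le> C"
  defines "\<delta> \<equiv> u - t" and "\<Lambda> \<equiv> k * ln (u / t)"
  shows "\<phi> + \<delta> * \<omega> - (L * (k / \<epsilon>)\<^sup>2 + (k / \<epsilon>) * R + (k / \<epsilon> + 1 / \<epsilon>) * R + R + (k / \<epsilon>) * C) * \<delta>\<^sup>2
    \<le> exp (- \<Lambda>) * (\<phi> + \<delta> * (\<sigma> - R * \<delta>)) + \<Lambda> * exp (- \<Lambda>) * (\<phi> + t / k * (\<omega> - \<sigma>) - C * \<delta>)"
proof -
  define \<kappa> where "\<kappa> = k / \<epsilon>"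
  \<comment> \<open>This is \<open>\<Lambda> * t / k\<close>, the weight that multiplies
    \<open>\<omega> - \<sigma>\<close>; it falls short of \<open>\<delta>\<close> by at most
    \<open>\<delta>\<^sup>2 / \<epsilon>\<close>.\<close>
  define y where "y = t * ln (u / t)"
  define E where "E = exp (- \<Lambda>)"
  have t: "0 < t" "0 < u" "0 < \<delta>" using eps by (auto simp: \<delta>_def)
  have ut: "u / t = 1 + \<delta> / t" using t by (simp add: \<delta>_def field_simps)
  have l_pos: "0 \<le> ln (u / t)" unfolding ut using t by simp
  have l_up: "ln (u / t) \<le> \<delta> / t" unfolding ut using t by (intro ln_add_one_self_le_self) simp
  have l_lo: "\<delta> / u \<le> ln (u / t)"
  proof -
    have "ln (t / u) \<le> t / u - 1" using t by (intro ln_le_minus_one) simp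
    moreover have "ln (t / u) = - ln (u / t)" using t by (simp add: ln_div)
    moreover have "1 - t / u = \<delta> / u" using t by (simp add: \<delta>_def field_simps)
    ultimately show ?thesis by linarith
  qed
  have \<kappa>: "0 \<le> \<kappa>" using k eps by (simp add: \<kappa>_def)
  have \<Lambda>: "0 \<le> \<Lambda>" "\<Lambda> \<le> \<kappa> * \<delta>"
  proof -
    show "0 \<le> \<Lambda>" unfolding \<Lambda>_def using l_pos k by simp
    have "\<delta> / t \<le> \<delta> / \<epsilon>" using eps t by (intro divide_left_mono) auto
    then have "k * ln (u / t) \<le> k * (\<delta> / \<epsilon>)" using l_up k by (intro mult_left_mono) auto
    then show "\<Lambda> \<le> \<kappa> * \<delta>" unfolding \<Lambda>_def \<kappa>_def by (simp add: mult_ac)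
  qed
  have y: "0 \<le> y" "y \<le> \<delta>" "\<delta> - \<delta>\<^sup>2 / \<epsilon> \<le> y"
  proof -
    show "0 \<le> y" unfolding y_def using l_pos t by simp
    have "t * ln (u / t) \<le> t * (\<delta> / t)" using l_up t by (intro mult_left_mono) auto
    then show "y \<le> \<delta>" unfolding y_def using t by simp
    have "t * (\<delta> / u) \<le> t * ln (u / t)" using l_lo t by (intro mult_left_mono) auto
    moreover have "t * (\<delta> / u) = \<delta> - \<delta>\<^sup>2 / u" using t by (simp add: \<delta>_def field_simps power2_eq_square)
    moreover have "\<delta>\<^sup>2 / u \<le> \<delta>\<^sup>2 / \<epsilon>" using eps t by (intro divide_left_mono) auto
    ultimately show "\<delta> - \<delta>\<^sup>2 / \<epsilon> \<le> y" unfolding y_def by linarith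
  qed
  have E: "0 \<le> E" "E \<le> 1" "1 - \<Lambda> \<le> E"
    unfolding E_def using \<Lambda> exp_ge_add_one_self[of "- \<Lambda>"] by auto
  have \<Lambda>2: "\<Lambda>\<^sup>2 \<le> \<kappa>\<^sup>2 * \<delta>\<^sup>2"
    using power_mono[OF \<Lambda>(2,1), of 2] by (simp add: power_mult_distrib)
  have 1: "\<phi> - L * \<kappa>\<^sup>2 * \<delta>\<^sup>2 \<le> E * (1 + \<Lambda>) * \<phi>"
  proof -
    have "(1 - \<Lambda>) * (1 + \<Lambda>) \<le> E * (1 + \<Lambda>)" using E \<Lambda> by (intro mult_right_mono) auto
    then have "(1 - \<Lambda>\<^sup>2) * \<phi> \<le> E * (1 + \<Lambda>) * \<phi>"
      using \<phi> by (intro mult_right_mono) (auto simp: algebra_simps power2_eq_square)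
    moreover have "\<phi> * \<Lambda>\<^sup>2 \<le> L * (\<kappa>\<^sup>2 * \<delta>\<^sup>2)" using \<phi> \<Lambda>2 by (intro mult_mono) auto
    ultimately show ?thesis by (simp add: algebra_simps)
  qed
  have 2: "\<delta> * \<sigma> - \<kappa> * R * \<delta>\<^sup>2 \<le> E * (\<delta> * \<sigma>)"
  proof -
    have "(1 - \<Lambda>) * (\<delta> * \<sigma>) \<le> E * (\<delta> * \<sigma>)" using E t \<sigma> by (intro mult_right_mono) auto
    moreover have "\<Lambda> * (\<delta> * \<sigma>) \<le> (\<kappa> * \<delta>) * (\<delta> * R)"
      using \<Lambda> \<sigma> t \<kappa> by (intro mult_mono) auto
    ultimately show ?thesis by (simp add: algebra_simps power2_eq_square)
  qed
  have 3: "E * (R * \<delta>\<^sup>2) \<le> R * \<delta>\<^sup>2"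
    using E \<sigma> by (intro mult_left_le_one_le) auto
  have 4: "\<Lambda> * E * (C * \<delta>) \<le> \<kappa> * C * \<delta>\<^sup>2"
  proof -
    have "\<Lambda> * E \<le> \<kappa> * \<delta> * 1" using \<Lambda> E \<kappa> t by (intro mult_mono) auto
    then have "\<Lambda> * E * (C * \<delta>) \<le> \<kappa> * \<delta> * 1 * (C * \<delta>)" using C t by (intro mult_right_mono) auto
    then show ?thesis by (simp add: algebra_simps power2_eq_square)
  qed
  have 5: "\<delta> * (\<omega> - \<sigma>) - (\<kappa> + 1 / \<epsilon>) * R * \<delta>\<^sup>2 \<le> E * y * (\<omega> - \<sigma>)"
  proof -
    have "E * y \<le> 1 * \<delta>" using E y by (intro mult_mono) auto
    \<comment> \<open>The sign of \<open>\<omega> - \<sigma>\<close> is unknown. If it is negative,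
      the nonnegativity of this shortfall settles the claim; otherwise its quadratic upper bound
      does.\<close>
    then have up: "0 \<le> \<delta> - E * y" by simp
    have "(1 - \<Lambda>) * y \<le> E * y" using E y by (intro mult_right_mono) auto
    moreover have "\<Lambda> * y \<le> \<kappa> * \<delta> * \<delta>" using \<Lambda> y \<kappa> t by (intro mult_mono) auto
    ultimately have "\<delta> - E * y \<le> (\<kappa> + 1 / \<epsilon>) * \<delta>\<^sup>2"
      using y(3) by (simp add: algebra_simps power2_eq_square)
    moreover have "\<omega> - \<sigma> \<le> R" using \<omega> \<sigma> by linarith
    ultimately have "(\<delta> - E * y) * (\<omega> - \<sigma>) \<le> (\<kappa> + 1 / \<epsilon>) * \<delta>\<^sup>2 * R"
    proof (cases "0 \<le> \<omega> - \<sigma>")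
      case True
      assume "\<delta> - E * y \<le> (\<kappa> + 1 / \<epsilon>) * \<delta>\<^sup>2" "\<omega> - \<sigma> \<le> R"
      then show ?thesis using up True by (intro mult_mono) auto
    next
      case False
      then have "(\<delta> - E * y) * (\<omega> - \<sigma>) \<le> 0" using up by (simp add: mult_nonneg_nonpos)
      moreover have "0 \<le> (\<kappa> + 1 / \<epsilon>) * \<delta>\<^sup>2 * R" using \<kappa> eps \<sigma> by simp
      ultimately show ?thesis by linarith
    qed
    then show ?thesis by (simp add: algebra_simps)
  qed
  have "\<Lambda> * E * (\<phi> + t / k * (\<omega> - \<sigma>) - C * \<delta>) = \<Lambda> * E * \<phi> + E * y * (\<omega> - \<sigma>) - \<Lambda> * E * (C * \<delta>)"
    unfolding y_def \<Lambda>_def using k by (simp add: field_simps)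
  then have "exp (- \<Lambda>) * (\<phi> + \<delta> * (\<sigma> - R * \<delta>)) + \<Lambda> * exp (- \<Lambda>) * (\<phi> + t / k * (\<omega> - \<sigma>) - C * \<delta>)
     = E * (1 + \<Lambda>) * \<phi> + E * (\<delta> * \<sigma>) - E * (R * \<delta>\<^sup>2) + E * y * (\<omega> - \<sigma>) - \<Lambda> * E * (C * \<delta>)"
    unfolding E_def[symmetric] by (simp add: algebra_simps power2_eq_square)
  moreover have "\<phi> + \<delta> * \<omega> - (L * \<kappa>\<^sup>2 + \<kappa> * R + (\<kappa> + 1 / \<epsilon>) * R + R + \<kappa> * C) * \<delta>\<^sup>2
     = (\<phi> - L * \<kappa>\<^sup>2 * \<delta>\<^sup>2) + (\<delta> * \<sigma> - \<kappa> * R * \<delta>\<^sup>2) - R * \<delta>\<^sup>2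
       + (\<delta> * (\<omega> - \<sigma>) - (\<kappa> + 1 / \<epsilon>) * R * \<delta>\<^sup>2) - \<kappa> * C * \<delta>\<^sup>2"
    by (simp add: algebra_simps)
  ultimately show ?thesis
    unfolding \<kappa>_def[symmetric] using 1 2 3 4 5 by linarith
qed

text \<open>Explicit Euler steps for \<open>\<phi>' \<ge> v - \<phi>\<close> with local error \<open>K \<delta>\<^sup>2\<close>.\<close>

lemma discrete_gronwall:
  fixes \<phi> :: "real \<Rightarrow> real"
  assumes ab: "a \<le> b" "b - a \<le> 1" and start: "0 \<le> \<phi> a" and v: "0 \<le> v" and K: "0 \<le> K"
    and step: "\<And>t u. a \<le> t \<Longrightarrow> t < u \<Longrightarrow> u \<le> b \<Longrightarrow> \<phi> t + (u - t) * (v - \<phi> t) - K * (u - t)\<^sup>2 \<le> \<phi> u"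
  shows "(1 - exp (- (b - a))) * v \<le> \<phi> b"
proof (cases "a = b")
  case True
  then show ?thesis using start by simp
next
  case False
  then have "a < b" using ab by simp
  have bound: "v - \<phi> b \<le> exp (- (b - a)) * v + K * (b - a)\<^sup>2 * inverse (real (Suc m))" for m
  proof -
    define \<delta> where "\<delta> = (b - a) / real (Suc m)"
    \<comment> \<open>The bound \<open>\<delta> \<le> 1\<close>, from \<open>b - a \<le> 1\<close>,
      keeps the factor \<open>1 - \<delta>\<close> nonnegative when the induction hypothesis is
      multiplied by it.\<close>
    have \<delta>: "0 < \<delta>" "\<delta> \<le> 1" "real (Suc m) * \<delta> = b - a"
      using \<open>a < b\<close> ab unfolding \<delta>_def by (auto simp: field_simps)
    have "v - \<phi> (a + real i * \<delta>) \<le> (1 - \<delta>) ^ i * v + real i * (K * \<delta>\<^sup>2)" if "i \<le> Suc m" for i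
      using that
    proof (induction i)
      case 0
      then show ?case using start by simp
    next
      case (Suc i)
      let ?t = "a + real i * \<delta>" and ?u = "a + real (Suc i) * \<delta>"
      have "real (Suc i) * \<delta> \<le> real (Suc m) * \<delta>" using Suc.prems \<delta> by (intro mult_right_mono) auto
      then have "?u \<le> b" using \<delta>(3) by linarith
      moreover have tu: "?u - ?t = \<delta>" by (simp add: algebra_simps)
      moreover have "a \<le> ?t" using \<delta>(1) by simp
      ultimately have "\<phi> ?t + \<delta> * (v - \<phi> ?t) - K * \<delta>\<^sup>2 \<le> \<phi> ?u"
        using step[of ?t ?u] \<delta>(1) by simp
      then have "v - \<phi> ?u \<le> (1 - \<delta>) * (v - \<phi> ?t) + K * \<delta>\<^sup>2" by (simp add: algebra_simps)
      also have "(1 - \<delta>) * (v - \<phi> ?t) \<le> (1 - \<delta>) * ((1 - \<delta>) ^ i * v + real i * (K * \<delta>\<^sup>2))"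
        using Suc \<delta> by (intro mult_left_mono) auto
      also have "(1 - \<delta>) * ((1 - \<delta>) ^ i * v + real i * (K * \<delta>\<^sup>2)) + K * \<delta>\<^sup>2
          = (1 - \<delta>) ^ Suc i * v + real (Suc i) * (K * \<delta>\<^sup>2) - \<delta> * (real i * (K * \<delta>\<^sup>2))"
        by (simp add: algebra_simps)
      also have "\<dots> \<le> (1 - \<delta>) ^ Suc i * v + real (Suc i) * (K * \<delta>\<^sup>2)"
        using \<delta> K by simp
      finally show ?case by simp
    qed
    from this[of "Suc m"] have "v - \<phi> b \<le> (1 - \<delta>) ^ Suc m * v + real (Suc m) * (K * \<delta>\<^sup>2)"
      using \<delta>(3) by simp
    \<comment> \<open>There are \<open>Suc m\<close> local errors, each quadratic in a step of
      length proportional to \<open>1 / Suc m\<close>, so their sum vanishes in the limit.\<close>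
    also have "real (Suc m) * (K * \<delta>\<^sup>2) = K * (b - a)\<^sup>2 * inverse (real (Suc m))"
      unfolding \<delta>_def by (simp add: field_simps power2_eq_square del: of_nat_Suc)
    also have "(1 - \<delta>) ^ Suc m * v \<le> exp (- \<delta>) ^ Suc m * v"
      using \<delta> exp_ge_add_one_self[of "- \<delta>"] v by (intro mult_right_mono power_mono) auto
    also have "exp (- \<delta>) ^ Suc m = exp (- (b - a))"
      unfolding exp_of_nat_mult[symmetric] \<delta>(3)[symmetric] by simp
    finally show ?thesis by simp
  qed
  have "(\<lambda>m. exp (- (b - a)) * v + K * (b - a)\<^sup>2 * inverse (real (Suc m)))
      \<longlonglongrightarrow> exp (- (b - a)) * v + K * (b - a)\<^sup>2 * 0"
    by (intro tendsto_intros LIMSEQ_inverse_real_of_nat)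
  then have "v - \<phi> b \<le> exp (- (b - a)) * v + K * (b - a)\<^sup>2 * 0"
    by (rule LIMSEQ_le_const) (use bound in auto)
  then show ?thesis by (simp add: algebra_simps)
qed

lemma integral_pmf_mono_finite:
  fixes g h :: "'b \<Rightarrow> real"
  assumes "finite (set_pmf p)" "\<And>x. x \<in> set_pmf p \<Longrightarrow> g x \<le> h x"
  shows "measure_pmf.expectation p g \<le> measure_pmf.expectation p h"
  by (rule integral_mono_AE) (use assms in \<open>auto intro: integrable_measure_pmf_finite simp: AE_measure_pmf_iff\<close>)

locale greedy_swap_objective = greedy_swap_run M U indep \<epsilon> swap A\<^sub>0 T X
  for M :: "'w measure" and U :: "'a set" and indep :: "'a set set" and \<epsilon> :: real
    and swap :: "real \<Rightarrow> 'a set \<Rightarrow> ('a \<times> 'a) pmf" and A\<^sub>0 :: "'a set"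
    and T :: "nat \<Rightarrow> 'w \<Rightarrow> real" and X :: "nat \<Rightarrow> 'w \<Rightarrow> 'a \<times> 'a" +
  fixes f :: "'a set \<Rightarrow> real" and Opt :: "'a set"
  assumes f_nonneg: "\<And>S. S \<subseteq> U \<Longrightarrow> f S \<ge> 0"
    and f_mono: "monotone_set_fun U f" and f_submodular: "submodular U f"
    and Opt_subset: "Opt \<subseteq> U"
    and above_average: "above_average U indep f Opt \<epsilon> swap"
begin

section \<open>Objective and derivative sums at a scaled base\<close>

definition \<Psi> :: "real \<Rightarrow> 'a set \<Rightarrow> real" where
  "\<Psi> t A = multilinear_ext U f (scaled_indicator A t)"

definition grad_sum :: "'a set \<Rightarrow> real \<Rightarrow> 'a set \<Rightarrow> real" where
  "grad_sum D t A = (\<Sum>d\<in>D. marginal_ext U f d (scaled_indicator A t))"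

definition gain :: "real \<Rightarrow> 'a set \<Rightarrow> real" where
  "gain t A = grad_sum Opt t A - grad_sum A t A"

lemma scaled_indicator_range: "t \<in> {0..1} \<Longrightarrow> 0 \<le> scaled_indicator A t j \<and> scaled_indicator A t j \<le> 1"
  by (simp add: indicator_def)

lemma \<Psi>_nonneg: "t \<in> {0..1} \<Longrightarrow> 0 \<le> \<Psi> t A"
  unfolding \<Psi>_def by (intro multilinear_ext_nonneg f_nonneg scaled_indicator_range)

lemma \<Psi>_mono: "0 \<le> s \<Longrightarrow> s \<le> t \<Longrightarrow> t \<le> 1 \<Longrightarrow> \<Psi> s A \<le> \<Psi> t A"
  unfolding \<Psi>_def by (intro multilinear_ext_mono[OF finite_ground f_mono]) (simp add: indicator_def)

lemma \<Psi>_1: "A \<subseteq> U \<Longrightarrow> \<Psi> 1 A = f A"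
  unfolding \<Psi>_def using multilinear_ext_indicator[OF finite_ground, of A f] by simp

lemma grad_eq: "i \<in> U \<Longrightarrow> grad U f t A i = marginal_ext U f i (scaled_indicator A t)"
  unfolding grad_def by (rule partial_deriv_multilinear_ext[OF finite_ground])

lemma grad_sum_nonneg: "D \<subseteq> U \<Longrightarrow> t \<in> {0..1} \<Longrightarrow> 0 \<le> grad_sum D t A"
  unfolding grad_sum_def
  by (intro sum_nonneg marginal_ext_nonneg[OF f_mono] scaled_indicator_range) auto

lemma \<Psi>_grad_sum_bounds:
  obtains L R where "0 \<le> L" "0 \<le> R"
    and "\<And>A t. A \<subseteq> U \<Longrightarrow> t \<in> {0..1} \<Longrightarrow> \<Psi> t A \<le> L"
    and "\<And>A D t. A \<subseteq> U \<Longrightarrow> D \<subseteq> U \<Longrightarrow> t \<in> {0..1} \<Longrightarrow> grad_sum D t A \<le> R"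
    and "\<And>A D s t. A \<subseteq> U \<Longrightarrow> D \<subseteq> U \<Longrightarrow> s \<in> {0..1} \<Longrightarrow> t \<in> {0..1} \<Longrightarrow>
      \<bar>grad_sum D s A - grad_sum D t A\<bar> \<le> R * \<bar>s - t\<bar>"
proof -
  obtain L where L: "0 \<le> L" "\<And>A t. A \<subseteq> U \<Longrightarrow> t \<in> {0..1} \<Longrightarrow> \<bar>\<Psi> t A\<bar> \<le> L"
    using multilinear_ext_scaled_indicator_bounds[of "Pow U" "\<lambda>_. U" "\<lambda>_. f" "\<lambda>A. A"] finite_ground
    unfolding \<Psi>_def by auto
  let ?m = "\<lambda>i A t. marginal_ext U f i (scaled_indicator A t)"
  obtain C where C: "0 \<le> C" "\<And>i A t. i \<in> U \<Longrightarrow> A \<subseteq> U \<Longrightarrow> t \<in> {0..1} \<Longrightarrow> \<bar>?m i A t\<bar> \<le> C"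
    "\<And>i A s t. i \<in> U \<Longrightarrow> A \<subseteq> U \<Longrightarrow> s \<in> {0..1} \<Longrightarrow> t \<in> {0..1} \<Longrightarrow> \<bar>?m i A s - ?m i A t\<bar> \<le> C * \<bar>s - t\<bar>"
    using multilinear_ext_scaled_indicator_bounds[of "U \<times> Pow U" "\<lambda>x. U - {fst x}"
        "\<lambda>x S. f (insert (fst x) S) - f S" snd] finite_ground
    unfolding marginal_ext_def by auto
  have card: "real (card D) * x \<le> real (card U) * x" if "D \<subseteq> U" "0 \<le> x" for D x
    using that finite_ground by (intro mult_right_mono) (auto intro: card_mono)
  have 1: "grad_sum D t A \<le> real (card U) * C" if "A \<subseteq> U" "D \<subseteq> U" "t \<in> {0..1}" for A D t
  proof -
    have "grad_sum D t A \<le> real (card D) * C"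
      unfolding grad_sum_def using C(2)[of _ A t] that by (intro sum_bounded_above) (auto simp: abs_le_iff)
    then show ?thesis using card[OF that(2) C(1)] by linarith
  qed
  have 2: "\<bar>grad_sum D s A - grad_sum D t A\<bar> \<le> real (card U) * C * \<bar>s - t\<bar>"
    if "A \<subseteq> U" "D \<subseteq> U" "s \<in> {0..1}" "t \<in> {0..1}" for A D s t
  proof -
    have "\<bar>grad_sum D s A - grad_sum D t A\<bar> \<le> (\<Sum>d\<in>D. \<bar>?m d A s - ?m d A t\<bar>)"
      unfolding grad_sum_def sum_subtractf[symmetric] by (rule sum_abs)
    also have "\<dots> \<le> real (card D) * (C * \<bar>s - t\<bar>)"
      using C(3)[of _ A s t] that by (intro sum_bounded_above) auto
    also have "\<dots> \<le> real (card U) * (C * \<bar>s - t\<bar>)" using card[OF that(2)] C(1) by simp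
    finally show ?thesis by (simp add: mult.assoc)
  qed
  show thesis
  proof (rule that[of L "real (card U) * C"])
    show "\<Psi> t A \<le> L" if "A \<subseteq> U" "t \<in> {0..1}" for A t using L(2)[OF that] by (simp add: abs_le_iff)
  qed (use L(1) C(1) 1 2 in auto)
qed

lemma grad_sum_Opt_ge: "t \<in> {0..1} \<Longrightarrow> f Opt - \<Psi> t A \<le> grad_sum Opt t A"
  unfolding \<Psi>_def grad_sum_def
  by (rule marginal_ext_sum_ge[OF finite_ground f_submodular f_mono Opt_subset scaled_indicator_range])

text \<open>By submodularity the slopes are smallest at the upper end, so the derivative sum is
  taken at \<open>u\<close>. Moving it back to \<open>t\<close> later costs a Lipschitz term, which
  the factor \<open>u - t\<close> makes quadratic.\<close>

lemma \<Psi>_increment: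
  assumes "A \<subseteq> U" "0 \<le> t" "t \<le> u" "u \<le> 1"
  shows "\<Psi> t A + (u - t) * grad_sum A u A \<le> \<Psi> u A"
proof -
  have "(\<Sum>a\<in>A. (scaled_indicator A u a - scaled_indicator A t a) * marginal_ext U f a (scaled_indicator A u))
      \<le> \<Psi> u A - \<Psi> t A"
    unfolding \<Psi>_def
    by (rule multilinear_ext_increment_ge[OF finite_ground f_submodular])
      (use assms finite_subset[OF _ finite_ground] in \<open>auto simp: indicator_def\<close>)
  moreover have "(\<Sum>a\<in>A. (scaled_indicator A u a - scaled_indicator A t a) * marginal_ext U f a (scaled_indicator A u))
      = (u - t) * grad_sum A u A"
    unfolding grad_sum_def sum_distrib_left by (rule sum.cong) auto
  ultimately show ?thesis by simp
qed

text \<open>Exchanging \<open>i\<close> for \<open>j\<close> first lowers coordinate \<open>i\<close> to \<open>0\<close>, where the derivative in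
  direction \<open>j\<close> is at least as large as before.\<close>

lemma \<Psi>_exchange:
  assumes A: "A \<in> bases indep" and p: "i \<in> A" "j \<in> U" "exchange A (i, j) \<in> bases indep" and t: "t \<in> {0..1}"
  shows "\<Psi> t A + t * (marginal_ext U f j (scaled_indicator A t) - marginal_ext U f i (scaled_indicator A t))
    \<le> \<Psi> t (exchange A (i, j))"
proof (cases "j \<in> A")
  case True
  \<comment> \<open>Bases are maximal, so one contained in \<open>A\<close> is \<open>A\<close>
    itself; the exchange has removed nothing and \<open>i = j\<close>.\<close>
  have "exchange A (i, j) \<subseteq> A" using True unfolding exchange_def by auto
  then have eq: "exchange A (i, j) = A" using A p(3) unfolding bases_def by auto
  then have "i = j" using p(1) unfolding exchange_def by auto
  then show ?thesis using eq by simp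
next
  case False
  let ?x = "scaled_indicator A t"
  let ?y = "?x(i := 0)"
  have i: "i \<in> U" using p(1) bases_subset[OF A] by auto
  have z: "scaled_indicator (exchange A (i, j)) t = ?y(j := t)"
    using False p(1) by (auto simp: exchange_def indicator_def fun_eq_iff)
  have x: "?x = ?x(i := t)" using p(1) by (auto simp: fun_eq_iff)
  have y: "?y = ?y(j := 0)" using False by (auto simp: fun_eq_iff)
  have 1: "multilinear_ext U f ?x - multilinear_ext U f ?y = t * marginal_ext U f i ?x"
    using multilinear_ext_upd_diff[OF finite_ground i, of f ?x t 0] x by simp
  have 2: "multilinear_ext U f (?y(j := t)) - multilinear_ext U f ?y = t * marginal_ext U f j ?y"
    using multilinear_ext_upd_diff[OF finite_ground p(2), of f ?y t 0] y by simp
  have "marginal_ext U f j ?x \<le> marginal_ext U f j ?y"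
    by (rule marginal_ext_antimono[OF finite_ground f_submodular p(2)]) (use t in \<open>auto simp: indicator_def\<close>)
  then have "t * marginal_ext U f j ?x \<le> t * marginal_ext U f j ?y" using t by (intro mult_left_mono) auto
  then show ?thesis using 1 2 unfolding \<Psi>_def z by (simp add: right_diff_distrib)
qed

text \<open>\<open>\<Psi>_exchange\<close> is averaged over the outcomes of the call, and
  \<open>above_average\<close> bounds the mean derivative difference by \<open>gain t A / k\<close>.
  The factor \<open>t\<close> is the height of the coordinates exchanged.\<close>

lemma swap_gain:
  assumes A: "A \<in> bases indep" and t: "t \<in> {\<epsilon>..1}"
  shows "\<Psi> t A + t / k * gain t A \<le> measure_pmf.expectation (swap t A) (\<lambda>p. \<Psi> t (exchange A p))"
proof -
  let ?g = "\<lambda>(i, j). grad U f t A j - grad U f t A i"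
  have fin: "finite (set_pmf (swap t A))"
    by (rule finite_subset[OF _ finite_pairs]) (use set_pmf_swap(1)[OF A t] in blast)
  have "1 / k * gain t A \<le> measure_pmf.expectation (swap t A) ?g"
  proof -
    have "gain t A = (\<Sum>b\<in>Opt. grad U f t A b) - (\<Sum>a\<in>A. grad U f t A a)"
      unfolding gain_def grad_sum_def using Opt_subset bases_subset[OF A] by (simp add: grad_eq subset_iff)
    then show ?thesis using above_average A t unfolding above_average_def by simp
  qed
  then have "t * (1 / k * gain t A) \<le> t * measure_pmf.expectation (swap t A) ?g"
    using t eps by (intro mult_left_mono) auto
  then have "\<Psi> t A + t / k * gain t A \<le> measure_pmf.expectation (swap t A) (\<lambda>p. \<Psi> t A + t * ?g p)"
    by (subst Bochner_Integration.integral_add) (auto intro: integrable_measure_pmf_finite[OF fin])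
  also have "\<dots> \<le> measure_pmf.expectation (swap t A) (\<lambda>p. \<Psi> t (exchange A p))"
  proof (rule integral_pmf_mono_finite[OF fin])
    fix p assume p: "p \<in> set_pmf (swap t A)"
    have i: "fst p \<in> U" using set_pmf_swap[OF A t p] bases_subset[OF A] by auto
    show "\<Psi> t A + t * ?g p \<le> \<Psi> t (exchange A p)"
      using \<Psi>_exchange[OF A, of "fst p" "snd p" t] set_pmf_swap[OF A t p] i t eps
      by (simp add: case_prod_beta grad_eq)
  qed
  finally show ?thesis .
qed

definition \<phi> :: "real \<Rightarrow> real" where
  "\<phi> t = expectation (\<lambda>w. \<Psi> t (base_at t w))"

lemma \<phi>_step:
  obtains K where "0 \<le> K" "\<And>t u. \<epsilon> \<le> t \<Longrightarrow> t < u \<Longrightarrow> u \<le> 1 \<Longrightarrow>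
    \<phi> t + (u - t) * (f Opt - \<phi> t) - K * (u - t)\<^sup>2 \<le> \<phi> u"
proof -
  obtain L R where LR: "0 \<le> L" "0 \<le> R"
    and L: "\<And>A t. A \<subseteq> U \<Longrightarrow> t \<in> {0..1} \<Longrightarrow> \<Psi> t A \<le> L"
    and R: "\<And>A D t. A \<subseteq> U \<Longrightarrow> D \<subseteq> U \<Longrightarrow> t \<in> {0..1} \<Longrightarrow> grad_sum D t A \<le> R"
    and Lip: "\<And>A D s t. A \<subseteq> U \<Longrightarrow> D \<subseteq> U \<Longrightarrow> s \<in> {0..1} \<Longrightarrow> t \<in> {0..1} \<Longrightarrow>
      \<bar>grad_sum D s A - grad_sum D t A\<bar> \<le> R * \<bar>s - t\<bar>"
    using \<Psi>_grad_sum_bounds by metis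
  have k: "0 < k" using rank_pos by simp
  \<comment> \<open>Cost of replacing the event time \<open>s\<close> by \<open>t\<close> in
    \<open>s / k * gain s A\<close>: the two derivative sums in \<open>gain\<close> move by at most
    \<open>R * \<delta>\<close> each, and changing the factor \<open>s\<close> to \<open>t\<close>
    costs another \<open>R * \<delta>\<close>, since \<open>gain\<close> is at most \<open>R\<close>
    in absolute value.\<close>
  define C where "C = 3 * R / k"
  have C: "0 \<le> C" using LR k by (simp add: C_def)
  define K where "K = L * (k / \<epsilon>)\<^sup>2 + (k / \<epsilon>) * R + (k / \<epsilon> + 1 / \<epsilon>) * R + R + (k / \<epsilon>) * C"
  have "0 \<le> K" unfolding K_def using LR k eps C by simp
  moreover have "\<phi> t + (u - t) * (f Opt - \<phi> t) - K * (u - t)\<^sup>2 \<le> \<phi> u"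
    if tu: "\<epsilon> \<le> t" "t < u" "u \<le> 1" for t u
  proof -
    define \<delta> where "\<delta> = u - t"
    define \<Lambda> where "\<Lambda> = k * ln (u / t)"
    have t01: "t \<in> {0..1}" "u \<in> {0..1}" "t < 1" "t \<le> u" using tu eps by auto
    let ?D = "\<lambda>j. {w \<in> space M. num_events T t u w = j}"
    have D: "?D j \<in> events" for j by measurable
    have P: "prob (?D 0) = exp (- \<Lambda>)" "prob (?D 1) = \<Lambda> * exp (- \<Lambda>)"
      using prob_count[of t u] tu by (simp_all add: \<Lambda>_def)
    define \<sigma> where "\<sigma> = expectation (\<lambda>w. grad_sum (base_at t w) t (base_at t w))"
    define \<omega> where "\<omega> = expectation (\<lambda>w. grad_sum Opt t (base_at t w))"
    have E_mono: "expectation (\<lambda>w. g (base_at t w)) \<le> expectation (\<lambda>w. h (base_at t w))"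
      if "\<And>A. A \<subseteq> U \<Longrightarrow> g A \<le> h A" for g h :: "'a set \<Rightarrow> real"
      by (intro integral_mono integrable_base_at that base_at_subset)
    have \<phi>: "0 \<le> \<phi> t" "\<phi> t \<le> L"
      using E_mono[of "\<lambda>_. 0" "\<Psi> t"] E_mono[of "\<Psi> t" "\<lambda>_. L"] \<Psi>_nonneg[OF t01(1)] L[OF _ t01(1)]
      unfolding \<phi>_def by (auto simp: prob_space)
    have \<sigma>: "0 \<le> \<sigma>" "\<sigma> \<le> R"
      using E_mono[of "\<lambda>_. 0" "\<lambda>A. grad_sum A t A"] E_mono[of "\<lambda>A. grad_sum A t A" "\<lambda>_. R"]
        grad_sum_nonneg[OF _ t01(1)] R[OF _ _ t01(1)]
      unfolding \<sigma>_def by (auto simp: prob_space)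
    have \<omega>: "0 \<le> \<omega>" "\<omega> \<le> R"
      using E_mono[of "\<lambda>_. 0" "grad_sum Opt t"] E_mono[of "grad_sum Opt t" "\<lambda>_. R"]
        grad_sum_nonneg[OF Opt_subset t01(1)] R[OF _ Opt_subset t01(1)]
      unfolding \<omega>_def by (auto simp: prob_space)
    have \<omega>_ge: "f Opt - \<phi> t \<le> \<omega>"
    proof -
      have "expectation (\<lambda>w. f Opt - \<Psi> t (base_at t w)) \<le> \<omega>"
        unfolding \<omega>_def by (rule E_mono) (rule grad_sum_Opt_ge[OF t01(1)])
      then show ?thesis
        unfolding \<phi>_def using integrable_base_at[of "\<Psi> t" t] by (simp add: prob_space)
    qed
    have I: "integrable M (\<lambda>w. \<Psi> u (base_at u w) * indicator (?D j) w)" for j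
      using integrable_real_mult_indicator[OF D integrable_base_at[of "\<Psi> u" u]] by (simp add: mult_ac)
    have no_event: "exp (- \<Lambda>) * (\<phi> t + \<delta> * (\<sigma> - R * \<delta>)) \<le> expectation (\<lambda>w. \<Psi> u (base_at u w) * indicator (?D 0) w)"
    proof -
      have "expectation (\<lambda>w. \<Psi> t (base_at t w) + \<delta> * (grad_sum (base_at t w) t (base_at t w) - R * \<delta>))
        \<le> expectation (\<lambda>w. \<Psi> u (base_at t w))"
      proof (rule E_mono)
        fix A assume A: "A \<subseteq> U"
        have "grad_sum A t A - R * \<delta> \<le> grad_sum A u A"
          using Lip[OF A A t01(1,2)] tu unfolding \<delta>_def by (simp add: abs_le_iff)
        then have "\<delta> * (grad_sum A t A - R * \<delta>) \<le> \<delta> * grad_sum A u A"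
          using tu unfolding \<delta>_def by (intro mult_left_mono) auto
        then show "\<Psi> t A + \<delta> * (grad_sum A t A - R * \<delta>) \<le> \<Psi> u A"
          using \<Psi>_increment[OF A, of t u] t01 unfolding \<delta>_def by simp
      qed
      moreover have "expectation (\<lambda>w. \<Psi> t (base_at t w) + \<delta> * (grad_sum (base_at t w) t (base_at t w) - R * \<delta>))
         = \<phi> t + \<delta> * (\<sigma> - R * \<delta>)"
        unfolding \<phi>_def \<sigma>_def
        using integrable_base_at[of "\<Psi> t" t] integrable_base_at[of "\<lambda>A. grad_sum A t A" t]
        by (simp add: prob_space)
      ultimately have "(\<phi> t + \<delta> * (\<sigma> - R * \<delta>)) * prob (?D 0) \<le> expectation (\<lambda>w. \<Psi> u (base_at t w)) * prob (?D 0)"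
        by (intro mult_right_mono) auto
      then show ?thesis
        using expectation_no_event[OF tu(1) t01(3,4), of "\<Psi> u"] unfolding P by (simp add: mult.commute)
    qed
    have one_event: "\<Lambda> * exp (- \<Lambda>) * (\<phi> t + t / k * (\<omega> - \<sigma>) - C * \<delta>)
        \<le> expectation (\<lambda>w. \<Psi> u (base_at u w) * indicator (?D 1) w)"
    proof -
      \<comment> \<open>Lower bound for the expected value after a call at any time of
        \<open>{t..u}\<close>, expressed by quantities at \<open>t\<close> so that it depends on the
        base only.\<close>
      let ?c = "\<lambda>A. \<Psi> t A + t / k * gain t A - C * \<delta>"
      have "expectation (\<lambda>w. ?c (base_at t w)) * prob (?D 1)
         \<le> expectation (\<lambda>w. \<Psi> u (base_at u w) * indicator (?D 1) w)"
      proof (rule expectation_one_event[OF tu])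
        fix A s assume A: "A \<in> bases indep" and s: "s \<in> {t..u}"
        have AU: "A \<subseteq> U" using bases_subset[OF A] .
        have s01: "s \<in> {0..1}" "s \<in> {\<epsilon>..1}" using s tu eps by auto
        have fin: "finite (set_pmf (swap s A))"
          by (rule finite_subset[OF _ finite_pairs]) (use set_pmf_swap(1)[OF A s01(2)] in blast)
        have "R * \<bar>s - t\<bar> \<le> R * \<delta>" using s LR unfolding \<delta>_def by (intro mult_left_mono) auto
        then have "\<bar>grad_sum Opt s A - grad_sum Opt t A\<bar> \<le> R * \<delta>" "\<bar>grad_sum A s A - grad_sum A t A\<bar> \<le> R * \<delta>"
          using Lip[OF AU Opt_subset s01(1) t01(1)] Lip[OF AU AU s01(1) t01(1)] by linarith+
        then have "\<bar>gain s A - gain t A\<bar> \<le> 2 * (R * \<delta>)" unfolding gain_def by linarith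
        then have g1: "\<bar>t * (gain s A - gain t A)\<bar> \<le> 1 * (2 * (R * \<delta>))"
          by (intro abs_le_multI) (use t01 in auto)
        have "\<bar>gain s A\<bar> \<le> R"
          unfolding gain_def
          using R[OF AU Opt_subset s01(1)] R[OF AU AU s01(1)]
            grad_sum_nonneg[OF Opt_subset s01(1), of A] grad_sum_nonneg[OF AU s01(1), of A] by linarith
        then have g2: "\<bar>(s - t) * gain s A\<bar> \<le> \<delta> * R"
          by (intro abs_le_multI) (use s in \<open>auto simp: \<delta>_def\<close>)
        have "t * gain t A - 3 * R * \<delta> \<le> s * gain s A"
          using g1 g2 by (simp add: algebra_simps abs_le_iff)
        then have "(t * gain t A - 3 * R * \<delta>) / k \<le> s * gain s A / k"
          using k by (simp add: divide_right_mono)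
        then have "?c A \<le> \<Psi> t A + s / k * gain s A"
          by (simp add: C_def diff_divide_distrib)
        also have "\<dots> \<le> \<Psi> s A + s / k * gain s A" using \<Psi>_mono[of t s A] s t01 by simp
        also have "\<dots> \<le> measure_pmf.expectation (swap s A) (\<lambda>p. \<Psi> s (exchange A p))"
          by (rule swap_gain[OF A s01(2)])
        also have "\<dots> \<le> measure_pmf.expectation (swap s A) (\<lambda>p. \<Psi> u (exchange A p))"
          by (rule integral_pmf_mono_finite[OF fin]) (use \<Psi>_mono[of s u] s s01 t01 in auto)
        finally show "?c A \<le> \<dots>" .
      qed
      moreover have "expectation (\<lambda>w. ?c (base_at t w)) = \<phi> t + t / k * (\<omega> - \<sigma>) - C * \<delta>"
        unfolding \<phi>_def \<sigma>_def \<omega>_def gain_def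
        using integrable_base_at[of "\<Psi> t" t] integrable_base_at[of "\<lambda>A. grad_sum A t A" t]
          integrable_base_at[of "grad_sum Opt t" t]
        by (simp add: prob_space)
      ultimately show ?thesis unfolding P by (simp add: mult_ac)
    qed
    have "expectation (\<lambda>w. \<Psi> u (base_at u w) * indicator (?D 0) w + \<Psi> u (base_at u w) * indicator (?D 1) w) \<le> \<phi> u"
      unfolding \<phi>_def
    proof (rule integral_mono)
      show "\<Psi> u (base_at u w) * indicator (?D 0) w + \<Psi> u (base_at u w) * indicator (?D 1) w \<le> \<Psi> u (base_at u w)" for w
        using \<Psi>_nonneg[OF t01(2), of "base_at u w"] by (auto simp: indicator_def)
    qed (intro Bochner_Integration.integrable_add I integrable_base_at)+
    then have "expectation (\<lambda>w. \<Psi> u (base_at u w) * indicator (?D 0) w)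
        + expectation (\<lambda>w. \<Psi> u (base_at u w) * indicator (?D 1) w) \<le> \<phi> u"
      using I by simp
    moreover have "\<phi> t + \<delta> * \<omega> - K * \<delta>\<^sup>2 \<le> exp (- \<Lambda>) * (\<phi> t + \<delta> * (\<sigma> - R * \<delta>))
        + \<Lambda> * exp (- \<Lambda>) * (\<phi> t + t / k * (\<omega> - \<sigma>) - C * \<delta>)"
      unfolding K_def \<delta>_def \<Lambda>_def
      by (rule one_step_arith[OF eps(1) tu(1,2) k \<phi> \<sigma> \<omega> C])
    moreover have "\<delta> * (f Opt - \<phi> t) \<le> \<delta> * \<omega>"
      using \<omega>_ge tu unfolding \<delta>_def by (intro mult_left_mono) auto
    ultimately show ?thesis using no_event one_event unfolding \<delta>_def[symmetric] by linarith
  qed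
  ultimately show thesis by (rule that)
qed

text \<open>At time 1 the scaled indicator is a vertex of the cube, where the extension equals
  \<open>f\<close>. The differential inequality runs over an interval of length
  \<open>1 - \<epsilon>\<close> and starts from the trivial bound
  \<open>0 \<le> \<phi> \<epsilon>\<close>.\<close>

lemma expectation_returned_base:
  "integrable M (\<lambda>w. f (returned_base A\<^sub>0 T X w))"
  "(1 - exp (- (1 - \<epsilon>))) * f Opt \<le> expectation (\<lambda>w. f (returned_base A\<^sub>0 T X w))"
proof -
  have m: "(\<lambda>w. f (returned_base A\<^sub>0 T X w)) \<in> borel_measurable M"
    by (rule measurable_compose[OF returned_base_measurable]) simp
  have AE: "AE w in M. f (base_at 1 w) = f (returned_base A\<^sub>0 T X w)"
    using AE_returned_base by eventually_elim simp
  show "integrable M (\<lambda>w. f (returned_base A\<^sub>0 T X w))"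
    using integrable_cong_AE[OF fun_base_at_measurable m AE] integrable_base_at by simp
  have "expectation (\<lambda>w. f (returned_base A\<^sub>0 T X w)) = expectation (\<lambda>w. f (base_at 1 w))"
    using integral_cong_AE[OF fun_base_at_measurable m AE] by simp
  also have "\<dots> = \<phi> 1"
    unfolding \<phi>_def by (intro Bochner_Integration.integral_cong[OF refl]) (simp add: \<Psi>_1 base_at_subset)
  finally have eq: "expectation (\<lambda>w. f (returned_base A\<^sub>0 T X w)) = \<phi> 1" .
  obtain K where "0 \<le> K" "\<And>t u. \<epsilon> \<le> t \<Longrightarrow> t < u \<Longrightarrow> u \<le> 1 \<Longrightarrow>
    \<phi> t + (u - t) * (f Opt - \<phi> t) - K * (u - t)\<^sup>2 \<le> \<phi> u"
    using \<phi>_step by blast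
  moreover have "0 \<le> \<phi> \<epsilon>" unfolding \<phi>_def using \<Psi>_nonneg eps by (intro Bochner_Integration.integral_nonneg) auto
  ultimately show "(1 - exp (- (1 - \<epsilon>))) * f Opt \<le> expectation (\<lambda>w. f (returned_base A\<^sub>0 T X w))"
    unfolding eq using eps f_nonneg[OF Opt_subset] by (intro discrete_gronwall[where K = K]) auto
qed

end

lemma one_minus_exp_ge:
  fixes x :: real
  assumes "0 \<le> x" "x \<le> 1"
  shows "x * (1 - 1 / exp 1) \<le> 1 - exp (- x)"
proof -
  \<comment> \<open>The graph of \<open>exp\<close> lies below its chord between the arguments -1
    and 0, and \<open>- x\<close> is the mixture of these with weights \<open>x\<close> and
    \<open>1 - x\<close>.\<close>
  have "exp ((1 - x) *\<^sub>R 0 + x *\<^sub>R (- 1)) \<le> (1 - x) * exp 0 + x * exp (- 1 :: real)"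
    by (rule convex_onD[OF exp_convex]) (use assms in auto)
  then show ?thesis by (simp add: exp_minus field_simps)
qed

theorem theorem3p1:
  fixes U :: "'a set" and indep :: "'a set set" and k :: nat
    and f :: "'a set \<Rightarrow> real" and \<epsilon> :: real and Opt :: "'a set"
    and swap :: "real \<Rightarrow> 'a set \<Rightarrow> ('a \<times> 'a) pmf"
    and M :: "'w measure" and A\<^sub>0 :: "'a set"
    and T :: "nat \<Rightarrow> 'w \<Rightarrow> real" and X :: "nat \<Rightarrow> 'w \<Rightarrow> 'a \<times> 'a"
  assumes "matroid U indep" and "k = matroid_rank indep"
    and "\<And>S. S \<subseteq> U \<Longrightarrow> f S \<ge> 0"
    and "monotone_set_fun U f" and "submodular U f"
    and "0 < \<epsilon>" and "\<epsilon> \<le> 1"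
    and "Opt \<in> bases indep" and "is_arg_max f (\<lambda>S. S \<in> indep) Opt"
    and "swap_procedure U indep \<epsilon> swap"
    and "right_continuous_swap U indep \<epsilon> swap"
    and "above_average U indep f Opt \<epsilon> swap"
    and "greedy_swap_poisson_process M U indep \<epsilon> swap A\<^sub>0 T X"
  shows "(AE w in M. returned_base A\<^sub>0 T X w \<in> bases indep)
    \<and> integrable M (\<lambda>w. f (returned_base A\<^sub>0 T X w))
    \<and> (\<integral>w. f (returned_base A\<^sub>0 T X w) \<partial>M) \<ge> (1 - \<epsilon>) * (1 - 1 / exp 1) * f Opt
    \<and> integrable M (\<lambda>w. real (num_calls T w))
    \<and> (\<integral>w. real (num_calls T w) \<partial>M) = real k * ln (1 / \<epsilon>)"
proof -
  interpret greedy_swap_run M U indep \<epsilon> swap A\<^sub>0 T X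
    by (intro greedy_swap_run.intro greedy_swap_run_axioms.intro assms)
  have Opt: "Opt \<subseteq> U" using bases_subset[OF assms(8)] .
  interpret greedy_swap_objective M U indep \<epsilon> swap A\<^sub>0 T X f Opt
    by unfold_locales (use assms Opt in auto)
  have "AE w in M. returned_base A\<^sub>0 T X w \<in> bases indep"
    using AE_base_at_in_bases[OF order_refl] AE_returned_base by eventually_elim simp
  moreover have "(1 - \<epsilon>) * (1 - 1 / exp 1) * f Opt \<le> (1 - exp (- (1 - \<epsilon>))) * f Opt"
    by (intro mult_right_mono one_minus_exp_ge) (use assms Opt in auto)
  ultimately show ?thesis
    using expectation_returned_base num_calls_expectation assms(2) by auto
qed

end
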